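(* Let $\Omega\subset\mathbb{R}^n$ with $n\in\{2,3\}$ be a bounded convex domain, let $m\ge1$ be an odd natural number, $r>n/2$, $f\in L^r(\Omega)$, and let $\sigma\in C^\infty(\overline\Omega)^{n\times n}$ be symmetric with $\underline\lambda|\xi|^2\le\sigma(x)\xi\cdot\xi\le\overline\lambda|\xi|^2$ for all $\xi\in\mathbb{R}^n$ and a.e. $x\in\Omega$, where $0<\underline\lambda\le\overline\lambda<\infty$. Assume that there is a constant $c_f>0$ with $f(x)\ge c_f$ for a.e. $x\in\Omega$. Let $0\le\underline q\le\overline q<\infty$ and $\mathcal A:=\{q\in L^\infty(\Omega):\underline q\le q\le\overline q\text{ a.e. in }\Omega\}$. Then there exists $c^\dagger>0$ such that $$u(q)(x)\ge\begin{cases}c^\dagger\rho(x)^{2+\frac1{m-1}}&\text{for all }x\in\overline\Omega,\ q\in\mathcal A,\quad\text{if }m>1,\\ c^\dagger\rho(x)^2&\text{for all }x\in\overline\Omega,\ q\in\mathcal A,\quad\text{if }m=1.\end{cases}$$ In particular, for every $q^\dagger\in\mathcal A$ there exist $C_\gamma,\gamma>0$ such that $u(q^\dagger)(x)\ge C_\gamma\rho(x)^\gamma$ for all $x\in\overline\Omega$.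
   Context: For a nonnegative $q\in L^r(\Omega)$, $u(q)\in H_0^1(\Omega)\cap C(\overline\Omega)$ denotes the unique weak solution of $-\nabla\cdot(\sigma\nabla u)+qu^m=f$ in $\Omega$, $u=0$ on $\partial\Omega$, i.e. $\int_\Omega\sigma\nabla u\cdot\nabla v\,dx+\int_\Omega qu^mv\,dx=\int_\Omega fv\,dx$ for all $v\in H^1_0(\Omega)$. The distance function is $\rho(x):=\mathrm{dist}(x,\partial\Omega)$, $x\in\overline\Omega$. *)

theory Defs
  imports "HOL-Analysis.Analysis"
begin

text \<open>Functions on a set \<open>\<Omega>\<close> are total functions of which only the values on \<open>\<Omega>\<close>
  (or on \<open>closure \<Omega>\<close>) matter; \<open>L\<^sup>p\<close> and Sobolev functions are representatives of their
  a.e.-classes.\<close>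

definition Lp_on :: "real \<Rightarrow> (real ^ 'n) set \<Rightarrow> (real ^ 'n \<Rightarrow> 'b::{real_normed_vector, second_countable_topology}) set"
  where "Lp_on p \<Omega> = {f \<in> borel_measurable (lebesgue_on \<Omega>).
           integrable (lebesgue_on \<Omega>) (\<lambda>x. norm (f x) powr p)}"

definition Linf_on :: "(real ^ 'n) set \<Rightarrow> (real ^ 'n \<Rightarrow> real) set"
  where "Linf_on \<Omega> = {f \<in> borel_measurable (lebesgue_on \<Omega>).
           \<exists>C. AE x in lebesgue_on \<Omega>. \<bar>f x\<bar> \<le> C}"

definition partial_deriv :: "'n::finite \<Rightarrow> (real ^ 'n \<Rightarrow> real) \<Rightarrow> real ^ 'n \<Rightarrow> real"
  where "partial_deriv i f x = frechet_derivative f (at x) (axis i 1)"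

fun iter_partial_deriv :: "'n::finite list \<Rightarrow> (real ^ 'n \<Rightarrow> real) \<Rightarrow> real ^ 'n \<Rightarrow> real"
  where
    "iter_partial_deriv [] f = f"
  | "iter_partial_deriv (i # is) f = partial_deriv i (iter_partial_deriv is f)"

definition gradient :: "(real ^ 'n::finite \<Rightarrow> real) \<Rightarrow> real ^ 'n \<Rightarrow> real ^ 'n"
  where "gradient f x = (\<chi> i. partial_deriv i f x)"

text \<open>To be used for open \<open>S\<close> only, since \<^const>\<open>partial_deriv\<close> is taken in the whole space.\<close>

definition C_infinity_on :: "(real ^ 'n::finite) set \<Rightarrow> (real ^ 'n \<Rightarrow> real) \<Rightarrow> bool"
  where "C_infinity_on S f \<longleftrightarrow> (\<forall>is. iter_partial_deriv is f differentiable_on S)"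

text \<open>The space \<open>C\<^sup>\<infinity>\<close> of the closure of an open set \<open>\<Omega>\<close>: every partial derivative, of any order,
  exists in \<open>\<Omega>\<close> and extends continuously to \<open>closure \<Omega>\<close>.\<close>

definition C_infinity_closure :: "(real ^ 'n::finite) set \<Rightarrow> (real ^ 'n \<Rightarrow> real) \<Rightarrow> bool"
  where "C_infinity_closure \<Omega> f \<longleftrightarrow> continuous_on (closure \<Omega>) f \<and> C_infinity_on \<Omega> f \<and>
           (\<forall>is. \<exists>g. continuous_on (closure \<Omega>) g \<and> (\<forall>x\<in>\<Omega>. g x = iter_partial_deriv is f x))"

definition test_functions :: "(real ^ 'n::finite) set \<Rightarrow> (real ^ 'n \<Rightarrow> real) set"
  where "test_functions \<Omega> = {\<phi>. C_infinity_on UNIV \<phi> \<and>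
           compact (closure {x. \<phi> x \<noteq> 0}) \<and> closure {x. \<phi> x \<noteq> 0} \<subseteq> \<Omega>}"

text \<open>\<open>u\<close> belongs to \<open>H\<^sup>1\<close> and \<open>U\<close> is (a representative of) its weak gradient, which is
  determined by \<open>u\<close> up to a null set.\<close>

definition has_weak_gradient :: "(real ^ 'n::finite) set \<Rightarrow> (real ^ 'n \<Rightarrow> real) \<Rightarrow> (real ^ 'n \<Rightarrow> real ^ 'n) \<Rightarrow> bool"
  where "has_weak_gradient \<Omega> u U \<longleftrightarrow> u \<in> Lp_on 2 \<Omega> \<and> U \<in> Lp_on 2 \<Omega> \<and>
           (\<forall>\<phi>\<in>test_functions \<Omega>. \<forall>i.
              (LINT x|lebesgue_on \<Omega>. u x * partial_deriv i \<phi> x) =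
              - (LINT x|lebesgue_on \<Omega>. U x $ i * \<phi> x))"

text \<open>The closure of the test functions in the \<open>H\<^sup>1\<close> norm.\<close>

definition H1_0 :: "(real ^ 'n::finite) set \<Rightarrow> (real ^ 'n \<Rightarrow> real) set"
  where "H1_0 \<Omega> = {u. \<exists>U. has_weak_gradient \<Omega> u U \<and>
           (\<exists>\<phi>. (\<forall>k::nat. \<phi> k \<in> test_functions \<Omega>) \<and>
              (\<lambda>k. LINT x|lebesgue_on \<Omega>. (\<phi> k x - u x)\<^sup>2 + (norm (gradient (\<phi> k) x - U x))\<^sup>2)
                \<longlonglongrightarrow> 0)}"

text \<open>Since weak gradients are unique a.e., it does not matter how \<open>U\<close> and \<open>V\<close> are quantified.
  The homogeneous boundary condition is the membership in \<^const>\<open>H1_0\<close>.\<close>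

definition weak_solution ::
  "(real ^ 'n::finite) set \<Rightarrow> (real ^ 'n \<Rightarrow> real ^ 'n ^ 'n) \<Rightarrow> nat \<Rightarrow> (real ^ 'n \<Rightarrow> real) \<Rightarrow>
   (real ^ 'n \<Rightarrow> real) \<Rightarrow> (real ^ 'n \<Rightarrow> real) \<Rightarrow> bool"
  where "weak_solution \<Omega> \<sigma> m f q u \<longleftrightarrow>
           u \<in> H1_0 \<Omega> \<and> continuous_on (closure \<Omega>) u \<and>
           (\<exists>U. has_weak_gradient \<Omega> u U \<and>
              (\<forall>v\<in>H1_0 \<Omega>. \<forall>V. has_weak_gradient \<Omega> v V \<longrightarrow>
                 (LINT x|lebesgue_on \<Omega>. (\<sigma> x *v U x) \<bullet> V x) +
                 (LINT x|lebesgue_on \<Omega>. q x * u x ^ m * v x) =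
                 (LINT x|lebesgue_on \<Omega>. f x * v x)))"

definition admissible :: "(real ^ 'n::finite) set \<Rightarrow> real \<Rightarrow> real \<Rightarrow> (real ^ 'n \<Rightarrow> real) set"
  where "admissible \<Omega> qlo qhi = {q \<in> Linf_on \<Omega>. AE x in lebesgue_on \<Omega>. qlo \<le> q x \<and> q x \<le> qhi}"

definition bdist :: "(real ^ 'n::finite) set \<Rightarrow> real ^ 'n \<Rightarrow> real"
  where "bdist \<Omega> x = infdist x (frontier \<Omega>)"

end

theory Submission
  imports Defs
begin

text \<open>A bump \<open>W\<close> of height of order \<open>a * d\<^sup>2\<close>, supported in the ball of radius \<open>d = bdist \<Omega> x0\<close>
  around \<open>x0\<close>, has derivatives up to order two bounded by a multiple of \<open>a\<close>, uniformly in \<open>x0\<close>.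
  As \<open>f \<ge> cf > 0\<close>, it is a strict subsolution once \<open>a\<close> is small, and comparison with the solution
  gives \<open>u x0 \<ge> W x0\<close>, which is a fixed multiple of \<open>d\<^sup>2\<close>, for every \<open>m\<close>.  The powers of the
  distance with a larger exponent are dominated by the square.

  For the comparison, let test functions \<open>\<phi> k\<close> converge to \<open>u\<close> in \<open>H\<^sup>1\<close>, and let \<open>h\<close> be the smooth
  function with \<open>h t = exp (- 1 / t)\<close> for \<open>t > 0\<close> and \<open>h t = 0\<close> otherwise.  Then \<open>h (W - \<phi> k)\<close> is
  a test function; no positive parts of Sobolev functions are needed.  Testing with it and letting
  \<open>k\<close> tend to infinity shows that the integral of \<open>h (W - u)\<close> is not positive.\<close>

section \<open>Smooth functions\<close>

lemma partial_deriv_eq: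
  assumes "(f has_derivative f') (at x)"
  shows "partial_deriv i f x = f' (axis i 1)"
  unfolding partial_deriv_def using frechet_derivative_at[OF assms] by simp

text \<open>\<open>frechet_derivative\<close> is a choice among the derivatives at \<open>x\<close>,
  so it is enough that both functions have the same ones. This also covers points where neither
  function is differentiable.\<close>

lemma partial_deriv_cong_open:
  assumes "open S" "x \<in> S" "\<And>y. y \<in> S \<Longrightarrow> f y = g y"
  shows "partial_deriv i f x = partial_deriv i g x"
proof -
  have "(f has_derivative D) (at x) \<longleftrightarrow> (g has_derivative D) (at x)" for D
    using has_derivative_transform_within_open[of f D x UNIV S g]
      has_derivative_transform_within_open[of g D x UNIV S f] assms by auto
  then show ?thesis by (simp add: partial_deriv_def frechet_derivative_def)
qed

lemma differentiable_cong_open: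
  assumes "open S" "x \<in> S" "\<And>y. y \<in> S \<Longrightarrow> f y = g y" "f differentiable (at x)"
  shows "g differentiable (at x)"
  using has_derivative_transform_within_open[of f _ x UNIV S g] assms unfolding differentiable_def by blast

text \<open>\<open>P\<close> serves as an invariant: by induction on the list, every iterated
  partial derivative agrees on \<open>S\<close> with some function satisfying \<open>P\<close>. No
  formula for higher derivatives has to be written down.\<close>

lemma C_infinity_on_coinduct:
  assumes "open S" "P f"
    and step: "\<And>f x. P f \<Longrightarrow> x \<in> S \<Longrightarrow> f differentiable (at x)"
      "\<And>f i. P f \<Longrightarrow> \<exists>g. P g \<and> (\<forall>x\<in>S. partial_deriv i f x = g x)"
  shows "C_infinity_on S f"
proof -
  have *: "\<exists>g. P g \<and> (\<forall>x\<in>S. iter_partial_deriv is f x = g x)" for "is"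
  proof (induction "is")
    case Nil
    then show ?case using assms(2) by auto
  next
    case (Cons i "is")
    then obtain g where g: "P g" "\<forall>x\<in>S. iter_partial_deriv is f x = g x" by blast
    obtain g' where "P g'" "\<forall>x\<in>S. partial_deriv i g x = g' x"
      using step(2)[OF g(1)] by blast
    then show ?case
      using partial_deriv_cong_open[OF \<open>open S\<close>, of _ "iter_partial_deriv is f" g] g(2)
      by (intro exI[of _ g']) auto
  qed
  show ?thesis
    unfolding C_infinity_on_def differentiable_on_eq_differentiable_at[OF \<open>open S\<close>]
  proof (intro allI ballI)
    fix "is" x assume x: "x \<in> S"
    obtain g where "P g" "\<forall>x\<in>S. iter_partial_deriv is f x = g x" using * by blast
    then show "iter_partial_deriv is f differentiable (at x)"
      using differentiable_cong_open[OF \<open>open S\<close> x, of g] step(1)[OF _ x] by simp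
  qed
qed

lemma C_infinity_on_differentiable:
  assumes "open S" "C_infinity_on S f" "x \<in> S"
  shows "f differentiable (at x)"
  using assms(2)[unfolded C_infinity_on_def, THEN spec, of "[]"] assms
  by (simp add: differentiable_on_eq_differentiable_at)

lemma C_infinity_on_partial_deriv:
  assumes "C_infinity_on S f"
  shows "C_infinity_on S (partial_deriv i f)"
proof -
  \<comment> \<open>The head of the list is the derivative taken last, so the one taken first goes
    to the end.\<close>
  have "iter_partial_deriv is (partial_deriv i f) = iter_partial_deriv (is @ [i]) f" for "is"
    by (induction "is") auto
  then show ?thesis using assms by (simp add: C_infinity_on_def)
qed

lemma C_infinity_on_cong:
  assumes "open S" "C_infinity_on S f" "\<And>x. x \<in> S \<Longrightarrow> f x = g x"
  shows "C_infinity_on S g"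
proof (rule C_infinity_on_coinduct[where P = "\<lambda>h. \<exists>f. C_infinity_on S f \<and> (\<forall>x\<in>S. f x = h x)"])
  fix h assume "\<exists>f. C_infinity_on S f \<and> (\<forall>x\<in>S. f x = h x)"
  then obtain f where f: "C_infinity_on S f" "\<And>x. x \<in> S \<Longrightarrow> f x = h x" by blast
  show "h differentiable (at x)" if "x \<in> S" for x
    by (rule differentiable_cong_open[OF \<open>open S\<close> that f(2) C_infinity_on_differentiable[OF \<open>open S\<close> f(1) that]])
  show "\<exists>g. (\<exists>f. C_infinity_on S f \<and> (\<forall>x\<in>S. f x = g x)) \<and> (\<forall>x\<in>S. partial_deriv i h x = g x)" for i
    by (intro exI[of _ "partial_deriv i f"] conjI ballI refl C_infinity_on_partial_deriv f(1)
        partial_deriv_cong_open[OF \<open>open S\<close> _ f(2), symmetric])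
qed (use assms in auto)

text \<open>Smoothness is checked point by point, so it can be glued from two open pieces. Products
  with a coefficient that is smooth only in \<open>\<Omega>\<close> are treated this way.\<close>

lemma C_infinity_on_Un:
  assumes "open S" "open T" "C_infinity_on S f" "C_infinity_on T f"
  shows "C_infinity_on (S \<union> T) f"
  using assms by (auto simp: C_infinity_on_def differentiable_on_eq_differentiable_at open_Un)

lemma C_infinity_on_subset:
  assumes "C_infinity_on T f" "S \<subseteq> T"
  shows "C_infinity_on S f"
  using assms by (auto simp: C_infinity_on_def intro: differentiable_on_subset)

section \<open>Calculus rules for partial derivatives\<close>

lemma has_derivative_frechet:
  "f differentiable (at x) \<Longrightarrow> (f has_derivative frechet_derivative f (at x)) (at x)"
  by (simp add: frechet_derivative_works)

lemma partial_deriv_add: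
  assumes "f differentiable (at x)" "g differentiable (at x)"
  shows "partial_deriv i (\<lambda>x. f x + g x) x = partial_deriv i f x + partial_deriv i g x"
  by (subst partial_deriv_eq[OF has_derivative_add[OF assms[THEN has_derivative_frechet]]])
     (simp add: partial_deriv_def)

lemma partial_deriv_mult:
  assumes "f differentiable (at x)" "g differentiable (at x)"
  shows "partial_deriv i (\<lambda>x. f x * g x) x = f x * partial_deriv i g x + partial_deriv i f x * g x"
  by (subst partial_deriv_eq[OF has_derivative_mult[OF assms[THEN has_derivative_frechet]]])
     (simp add: partial_deriv_def)

lemma has_derivative_real_compose:
  fixes g :: "real ^ 'n::finite \<Rightarrow> real"
  assumes "(h has_real_derivative h') (at (g x))" "g differentiable (at x)"
  shows "((\<lambda>x. h (g x)) has_derivative (\<lambda>v. h' * frechet_derivative g (at x) v)) (at x)"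
  using has_derivative_compose[OF has_derivative_frechet[OF assms(2)]
      assms(1)[unfolded has_field_derivative_def]] by simp

lemma partial_deriv_compose:
  assumes "(h has_real_derivative h') (at (g x))" "g differentiable (at x)"
  shows "partial_deriv i (\<lambda>x. h (g x)) x = h' * partial_deriv i g x"
  by (subst partial_deriv_eq[OF has_derivative_real_compose[OF assms]])
     (simp add: partial_deriv_def)

lemma partial_deriv_const [simp]: "partial_deriv i (\<lambda>x. c) x = 0"
  by (subst partial_deriv_eq[OF has_derivative_const]) simp

lemma has_derivative_component:
  "((\<lambda>x. x $ j) has_derivative (\<lambda>x. x $ j)) (at (x :: real ^ 'n::finite))"
  by (rule bounded_linear.has_derivative[OF bounded_linear_vec_nth has_derivative_ident])

lemma partial_deriv_component:
  "partial_deriv i (\<lambda>x. x $ j) x = (if i = j then 1 else 0)"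
  by (subst partial_deriv_eq[OF has_derivative_component]) (auto simp: axis_def)

text \<open>This class is closed under partial derivatives on \<open>S\<close>, hence consists of smooth functions
  by coinduction.\<close>

inductive smooth_expr :: "(real ^ 'n::finite) set \<Rightarrow> (real ^ 'n \<Rightarrow> real) \<Rightarrow> bool"
  for S where
  base: "C_infinity_on S f \<Longrightarrow> smooth_expr S f"
| const: "smooth_expr S (\<lambda>x. c)"
| component: "smooth_expr S (\<lambda>x. x $ i)"
| add: "smooth_expr S f \<Longrightarrow> smooth_expr S g \<Longrightarrow> smooth_expr S (\<lambda>x. f x + g x)"
| mult: "smooth_expr S f \<Longrightarrow> smooth_expr S g \<Longrightarrow> smooth_expr S (\<lambda>x. f x * g x)"
| compose: "(\<And>n t. (D n has_real_derivative D (Suc n) t) (at t)) \<Longrightarrow> smooth_expr S g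
    \<Longrightarrow> smooth_expr S (\<lambda>x. D (n::nat) (g x))"

lemma smooth_expr_differentiable:
  assumes "open S" "smooth_expr S f" "x \<in> S"
  shows "f differentiable (at x)"
  using assms(2)
proof induction
  case (base f)
  then show ?case using assms C_infinity_on_differentiable by blast
next
  case (component i)
  then show ?case using has_derivative_component by (auto simp: differentiable_def)
next
  case (compose D g n)
  then show ?case
    using has_derivative_real_compose[of "D n" "D (Suc n) (g x)" g x] unfolding differentiable_def by blast
qed (auto intro: differentiable_add differentiable_mult)

text \<open>The derivative is matched only on \<open>S\<close>, since the \<open>base\<close>
  functions are known to be differentiable only there. In the composition case the chain rule moves
  one index up the sequence \<open>D\<close>, so the class is not left.\<close>

lemma smooth_expr_partial_deriv:
  assumes "open S" "smooth_expr S f"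
  shows "\<exists>g. smooth_expr S g \<and> (\<forall>x\<in>S. partial_deriv i f x = g x)"
  using assms(2)
proof induction
  case (base f)
  then show ?case using C_infinity_on_partial_deriv smooth_expr.base by blast
next
  case (const c)
  then show ?case using smooth_expr.const by auto
next
  case (component j)
  then show ?case using smooth_expr.const by (auto simp: partial_deriv_component)
next
  case (add f g)
  then obtain f' g' where "smooth_expr S f'" "\<forall>x\<in>S. partial_deriv i f x = f' x"
    "smooth_expr S g'" "\<forall>x\<in>S. partial_deriv i g x = g' x" by blast
  then show ?case
    using add smooth_expr_differentiable[OF \<open>open S\<close>]
    by (intro exI[of _ "\<lambda>x. f' x + g' x"]) (auto simp: partial_deriv_add intro: smooth_expr.add)
next
  case (mult f g)
  then obtain f' g' where "smooth_expr S f'" "\<forall>x\<in>S. partial_deriv i f x = f' x"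
    "smooth_expr S g'" "\<forall>x\<in>S. partial_deriv i g x = g' x" by blast
  then show ?case
    using mult smooth_expr_differentiable[OF \<open>open S\<close>]
    by (intro exI[of _ "\<lambda>x. f x * g' x + f' x * g x"])
       (auto simp: partial_deriv_mult intro: smooth_expr.add smooth_expr.mult)
next
  case (compose D g n)
  obtain g' where g': "smooth_expr S g'" "\<forall>x\<in>S. partial_deriv i g x = g' x"
    using compose.IH by blast
  have D: "smooth_expr S (\<lambda>x. D (Suc n) (g x))"
    by (rule smooth_expr.compose[of D, OF compose.hyps])
  have "partial_deriv i (\<lambda>x. D n (g x)) x = D (Suc n) (g x) * partial_deriv i g x" if "x \<in> S" for x
    by (rule partial_deriv_compose[OF compose.hyps(1) smooth_expr_differentiable[OF \<open>open S\<close> compose.hyps(2) that]])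
  with g'(2) show ?case
    by (intro exI[of _ "\<lambda>x. D (Suc n) (g x) * g' x"] conjI smooth_expr.mult D g'(1)) simp
qed

lemma smooth_expr_C_infinity_on:
  assumes "open S" "smooth_expr S f"
  shows "C_infinity_on S f"
proof (rule C_infinity_on_coinduct[of S "smooth_expr S"])
  show "f differentiable (at x)" if "smooth_expr S f" "x \<in> S" for f x
    by (rule smooth_expr_differentiable[OF \<open>open S\<close> that])
  show "\<exists>g. smooth_expr S g \<and> (\<forall>x\<in>S. partial_deriv i f x = g x)" if "smooth_expr S f" for f i
    by (rule smooth_expr_partial_deriv[OF \<open>open S\<close> that])
qed (fact assms)+

lemma C_infinity_on_mult:
  "open S \<Longrightarrow> C_infinity_on S f \<Longrightarrow> C_infinity_on S g \<Longrightarrow> C_infinity_on S (\<lambda>x. f x * g x)"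
  by (rule smooth_expr_C_infinity_on[OF _ smooth_expr.mult[OF smooth_expr.base smooth_expr.base]])

lemma C_infinity_on_add:
  "open S \<Longrightarrow> C_infinity_on S f \<Longrightarrow> C_infinity_on S g \<Longrightarrow> C_infinity_on S (\<lambda>x. f x + g x)"
  by (rule smooth_expr_C_infinity_on[OF _ smooth_expr.add[OF smooth_expr.base smooth_expr.base]])

lemma C_infinity_on_const: "open S \<Longrightarrow> C_infinity_on S (\<lambda>x. c)"
  by (rule smooth_expr_C_infinity_on[OF _ smooth_expr.const])

section \<open>The function exp(-1/t), extended by zero, and its derivatives\<close>

definition flat :: "real poly \<Rightarrow> real \<Rightarrow> real"
  where "flat p t = (if t > 0 then poly p (1 / t) * exp (- (1 / t)) else 0)"

text \<open>In the variable s = 1/t, differentiating p(s) exp(-s) with respect to t gives s^2 (p(s)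
  - p'(s)) exp(-s); the factor \<open>[:0, 0, 1:]\<close> is s^2. Thus \<open>flat\<close> of a
  polynomial differentiates to \<open>flat\<close> of another polynomial.\<close>

fun flat_poly :: "nat \<Rightarrow> real poly" where
  "flat_poly 0 = 1"
| "flat_poly (Suc n) = [:0, 0, 1:] * (flat_poly n - pderiv (flat_poly n))"

text \<open>\<open>bump 0\<close> is the function \<open>h\<close> of the outline and
  \<open>bump n\<close> is its n-th derivative. Keeping all of them in one sequence fits the
  composition rule of \<open>smooth_expr\<close>.\<close>

definition bump :: "nat \<Rightarrow> real \<Rightarrow> real"
  where "bump n = flat (flat_poly n)"

text \<open>The k-th power of the inequality s/k <= exp(s/k).\<close>

lemma power_mult_exp_le:
  fixes s :: real
  assumes "s \<ge> 0"
  shows "s ^ k * exp (- s) \<le> real k ^ k"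
proof (cases "k = 0")
  case False
  have "s / real k \<le> exp (s / real k)"
    using exp_ge_add_one_self[of "s / real k"] by linarith
  then have "(s / real k) ^ k \<le> exp (s / real k) ^ k"
    using assms by (intro power_mono) auto
  also have "\<dots> = exp s"
    using False by (simp flip: exp_of_nat_mult)
  finally have "(s / real k) ^ k * (real k ^ k * exp (- s)) \<le> exp s * (real k ^ k * exp (- s))"
    by (intro mult_right_mono) auto
  moreover have "(s / real k) ^ k * (real k ^ k * exp (- s)) = s ^ k * exp (- s)"
    using False by (simp add: power_divide)
  moreover have "exp s * (real k ^ k * exp (- s)) = real k ^ k"
    by (simp add: exp_minus)
  ultimately show ?thesis by simp
qed (use assms in auto)

lemma poly_mult_exp_bounded:
  fixes p :: "real poly"
  obtains C where "\<And>s. s \<ge> 0 \<Longrightarrow> \<bar>poly p s\<bar> * exp (- s) \<le> C"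
proof
  fix s :: real assume s: "s \<ge> 0"
  have "\<bar>poly p s\<bar> * exp (- s) \<le> (\<Sum>i\<le>degree p. \<bar>coeff p i * s ^ i\<bar>) * exp (- s)"
    unfolding poly_altdef by (intro mult_right_mono sum_abs) auto
  also have "\<dots> = (\<Sum>i\<le>degree p. \<bar>coeff p i\<bar> * (s ^ i * exp (- s)))"
    using s by (simp add: sum_distrib_right abs_mult mult.assoc)
  also have "\<dots> \<le> (\<Sum>i\<le>degree p. \<bar>coeff p i\<bar> * real i ^ i)"
    by (intro sum_mono mult_left_mono power_mult_exp_le s) auto
  finally show "\<bar>poly p s\<bar> * exp (- s) \<le> (\<Sum>i\<le>degree p. \<bar>coeff p i\<bar> * real i ^ i)" .
qed

text \<open>The exponential beats every polynomial in s = 1/t. The bound serves twice: near t = 0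
  for differentiability, and globally for estimates of the barrier that do not depend on its
  radius.\<close>

lemma flat_bounded:
  obtains C where "\<And>t. \<bar>flat p t\<bar> \<le> C"
proof -
  obtain C where C: "\<And>s. s \<ge> 0 \<Longrightarrow> \<bar>poly p s\<bar> * exp (- s) \<le> C"
    using poly_mult_exp_bounded by blast
  have "0 \<le> C" using C[of 0] by (smt (verit) exp_gt_zero zero_le_mult_iff abs_ge_zero)
  then have "\<bar>flat p t\<bar> \<le> C" for t
    using C[of "1/t"] by (auto simp: flat_def abs_mult)
  then show ?thesis using that by blast
qed

text \<open>Away from 0 this is the product and chain rule on an open half-line. At 0 the difference
  quotient tends to 0.\<close>

lemma flat_has_derivative:
  "(flat p has_real_derivative flat ([:0, 0, 1:] * (p - pderiv p)) t) (at t)"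
proof (cases t "0 :: real" rule: linorder_cases)
  case greater
  have "((\<lambda>t. poly p (1 / t) * exp (- (1 / t))) has_real_derivative
      poly p (1 / t) * (exp (- (1 / t)) * (1 / t\<^sup>2)) + (poly (pderiv p) (1 / t) * (- 1 / t\<^sup>2)) * exp (- (1 / t))) (at t)"
    using greater
    by (intro DERIV_mult' DERIV_chain'[where g = "poly p"] poly_DERIV)
       (auto intro!: derivative_eq_intros simp: power2_eq_square)
  then have "((\<lambda>t. poly p (1 / t) * exp (- (1 / t))) has_real_derivative
      flat ([:0, 0, 1:] * (p - pderiv p)) t) (at t)"
    by (rule DERIV_cong) (use greater in \<open>simp add: flat_def power2_eq_square algebra_simps\<close>)
  then show ?thesis
    by (rule has_field_derivative_transform_within_open[where S = "{0<..}"])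
       (use greater in \<open>auto simp: flat_def\<close>)
next
  case less
  have "((\<lambda>t. 0) has_real_derivative flat ([:0, 0, 1:] * (p - pderiv p)) t) (at t)"
    using less by (auto simp: flat_def)
  then show ?thesis
    by (rule has_field_derivative_transform_within_open[where S = "{..<0}"])
       (use less in \<open>auto simp: flat_def\<close>)
next
  case equal
  \<comment> \<open>The bound is taken for s^2 p instead of p: for y > 0,
    \<open>flat p y / y\<close> equals y times \<open>flat\<close> of s^2 p at y, hence is at most C
    |y| in modulus.\<close>
  obtain C where C: "\<And>t. \<bar>flat ([:0, 0, 1:] * p) t\<bar> \<le> C"
    using flat_bounded by blast
  have *: "\<bar>flat p y / y\<bar> \<le> C * \<bar>y\<bar>" for y
  proof (cases "y > 0")
    case True
    then have "flat ([:0, 0, 1:] * p) y * y = flat p y / y"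
      by (simp add: flat_def)
    then have "\<bar>flat p y / y\<bar> = \<bar>flat ([:0, 0, 1:] * p) y\<bar> * \<bar>y\<bar>"
      by (simp add: abs_mult flip: \<open>_ = flat p y / y\<close>)
    also have "\<dots> \<le> C * \<bar>y\<bar>"
      by (intro mult_right_mono C) auto
    finally show ?thesis .
  next
    case False
    have "0 \<le> C" using C[of 0] by linarith
    with False show ?thesis by (simp add: flat_def mult_nonneg_nonpos)
  qed
  have "((\<lambda>y. flat p y / y) \<longlongrightarrow> 0) (at 0)"
    by (rule Lim_null_comparison[where g = "\<lambda>y. C * \<bar>y\<bar>"])
       (use * in \<open>auto intro!: tendsto_eq_intros\<close>)
  then show ?thesis
    using equal by (simp add: has_field_derivative_iff flat_def)
qed

lemma bump_has_derivative: "(bump n has_real_derivative bump (Suc n) t) (at t)"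
  using flat_has_derivative by (simp add: bump_def)

lemma bump_0: "bump 0 t = (if t > 0 then exp (- (1 / t)) else 0)"
  by (simp add: bump_def flat_def)

lemma bump_0_bounds: "0 \<le> bump 0 t" "bump 0 t \<le> 1"
  by (auto simp: bump_0)

lemma bump_1_nonneg: "0 \<le> bump (Suc 0) t"
  by (auto simp: bump_def flat_def)

lemma bump_nonpos: "t \<le> 0 \<Longrightarrow> bump n t = 0"
  by (auto simp: bump_def flat_def)

lemma bump_bounded:
  obtains C where "C > 0" "\<And>t. \<bar>bump n t\<bar> \<le> C"
proof -
  obtain C where "\<And>t. \<bar>bump n t\<bar> \<le> C"
    unfolding bump_def using flat_bounded by blast
  then show ?thesis by (intro that[of "max 1 C"]) (auto simp: max.coboundedI2)
qed

lemma C_infinity_on_bump: "open S \<Longrightarrow> C_infinity_on S g \<Longrightarrow> C_infinity_on S (\<lambda>x. bump n (g x))"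
  by (rule smooth_expr_C_infinity_on[OF _ smooth_expr.compose[of bump, OF bump_has_derivative smooth_expr.base]])

section \<open>Test functions\<close>

lemma test_functionsI:
  assumes "C_infinity_on UNIV g" "{x. g x \<noteq> 0} \<subseteq> K" "compact K" "K \<subseteq> \<Omega>"
  shows "g \<in> test_functions \<Omega>"
proof -
  have "closure {x. g x \<noteq> 0} \<subseteq> K"
    using assms by (intro closure_minimal compact_imp_closed)
  moreover from this have "compact (closure {x. g x \<noteq> 0})"
    using compact_Int_closed[OF assms(3), of "closure {x. g x \<noteq> 0}"] by (simp add: Int_absorb1)
  ultimately show ?thesis using assms(1,4) unfolding test_functions_def by blast
qed

lemma test_functionsE:
  assumes "g \<in> test_functions \<Omega>"
  obtains K where "C_infinity_on UNIV g" "\<forall>x. x \<notin> K \<longrightarrow> g x = 0" "compact K" "K \<subseteq> \<Omega>"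
proof (rule that[of "closure {x. g x \<noteq> 0}"])
  show "\<forall>x. x \<notin> closure {x. g x \<noteq> 0} \<longrightarrow> g x = 0"
    using closure_subset[of "{x. g x \<noteq> 0}"] by blast
qed (use assms in \<open>simp_all add: test_functions_def\<close>)

lemma test_function_partial_deriv:
  assumes "g \<in> test_functions \<Omega>"
  shows "partial_deriv i g \<in> test_functions \<Omega>"
proof -
  obtain K where K: "C_infinity_on UNIV g" "\<forall>x. x \<notin> K \<longrightarrow> g x = 0" "compact K" "K \<subseteq> \<Omega>"
    using test_functionsE[OF assms] by blast
  have "partial_deriv i g x = 0" if "x \<notin> K" for x
  proof -
    have "partial_deriv i g x = partial_deriv i (\<lambda>x. 0) x"
      by (rule partial_deriv_cong_open[of "- K"])
         (use K that in \<open>auto simp: open_Compl compact_imp_closed\<close>)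
    then show ?thesis by simp
  qed
  with K show ?thesis
    by (intro test_functionsI[of _ K]) (auto intro: C_infinity_on_partial_deriv)
qed

text \<open>\<open>s\<close> may behave arbitrarily outside \<open>\<Omega>\<close>. The product is
  smooth in \<open>\<Omega>\<close> and zero on the open complement of the compact set
  \<open>K\<close> that carries \<open>g\<close>; as \<open>K\<close> lies in
  \<open>\<Omega>\<close>, these two open sets cover the space.\<close>

lemma test_function_mult_smooth:
  assumes "open \<Omega>" "C_infinity_on \<Omega> s" "g \<in> test_functions \<Omega>"
  shows "(\<lambda>x. s x * g x) \<in> test_functions \<Omega>"
proof -
  obtain K where K: "C_infinity_on UNIV g" "\<forall>x. x \<notin> K \<longrightarrow> g x = 0" "compact K" "K \<subseteq> \<Omega>"
    using test_functionsE[OF assms(3)] by blast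
  have o: "open (- K)" using K(3) by (simp add: open_Compl compact_imp_closed)
  have "C_infinity_on \<Omega> (\<lambda>x. s x * g x)"
    by (rule C_infinity_on_mult[OF assms(1,2) C_infinity_on_subset[OF K(1)]]) simp
  moreover have "C_infinity_on (- K) (\<lambda>x. s x * g x)"
    by (rule C_infinity_on_cong[OF o C_infinity_on_const[OF o]]) (use K in auto)
  moreover have "\<Omega> \<union> - K = UNIV" using K by auto
  ultimately have "C_infinity_on UNIV (\<lambda>x. s x * g x)"
    using C_infinity_on_Un[OF assms(1) o] by simp
  then show ?thesis
    by (rule test_functionsI[OF _ _ K(3,4)]) (use K in auto)
qed

lemma test_function_C_infinity:
  "g \<in> test_functions \<Omega> \<Longrightarrow> C_infinity_on S g"
  using C_infinity_on_subset[of UNIV g S] by (auto simp: test_functions_def)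

lemma test_function_differentiable:
  "g \<in> test_functions \<Omega> \<Longrightarrow> g differentiable (at x)"
  using C_infinity_on_differentiable[OF open_UNIV test_function_C_infinity] by simp

lemma test_function_continuous:
  assumes "g \<in> test_functions \<Omega>"
  shows "continuous_on S g"
  using assms by (intro continuous_at_imp_continuous_on ballI differentiable_imp_continuous_within
      test_function_differentiable)

lemma test_function_bounded:
  assumes "g \<in> test_functions \<Omega>"
  obtains C where "\<And>x. \<bar>g x\<bar> \<le> C"
proof -
  obtain K where K: "C_infinity_on UNIV g" "\<forall>x. x \<notin> K \<longrightarrow> g x = 0" "compact K" "K \<subseteq> \<Omega>"
    using test_functionsE[OF assms] by blast
  have "bounded (g ` K)"
    by (intro compact_imp_bounded compact_continuous_image K test_function_continuous[OF assms])
  then obtain C where "\<And>x. x \<in> K \<Longrightarrow> \<bar>g x\<bar> \<le> C"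
    by (auto simp: bounded_iff)
  with K(2) have "\<bar>g x\<bar> \<le> max 0 C" for x
    by (cases "x \<in> K") (auto simp: max.coboundedI2)
  then show ?thesis using that by blast
qed

lemma test_function_borel: "g \<in> test_functions \<Omega> \<Longrightarrow> g \<in> borel_measurable borel"
  by (intro borel_measurable_continuous_onI test_function_continuous)

lemma measurable_lebesgue_on_borel:
  "g \<in> borel_measurable borel \<Longrightarrow> g \<in> borel_measurable (lebesgue_on \<Omega>)"
  by (intro measurable_restrict_space1 measurable_completion) simp

lemma bounded_open_finite_measure:
  fixes \<Omega> :: "'a::euclidean_space set"
  assumes "open \<Omega>" "bounded \<Omega>"
  shows "finite_measure (lebesgue_on \<Omega>)"
  using assms by (intro finite_measure_lebesgue_on lmeasurable_open)

lemma integrable_on_bounded_open: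
  fixes \<Omega> :: "'a::euclidean_space set" and g :: "'a \<Rightarrow> real"
  assumes "open \<Omega>" "bounded \<Omega>" "g \<in> borel_measurable (lebesgue_on \<Omega>)" "\<And>x. x \<in> \<Omega> \<Longrightarrow> \<bar>g x\<bar> \<le> C"
  shows "integrable (lebesgue_on \<Omega>) g"
  by (rule finite_measure.integrable_const_bound[OF bounded_open_finite_measure[OF assms(1,2)] _ assms(3), of C])
     (use assms(4) in \<open>auto intro!: AE_I2\<close>)

lemma test_function_integrable:
  assumes "open \<Omega>" "bounded \<Omega>" "g \<in> test_functions \<Omega>"
  shows "integrable (lebesgue_on \<Omega>) g"
proof -
  obtain C where "\<And>x. \<bar>g x\<bar> \<le> C" using test_function_bounded[OF assms(3)] by blast
  then show ?thesis
    by (intro integrable_on_bounded_open assms measurable_lebesgue_on_borel test_function_borel[OF assms(3)])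
qed

text \<open>Passing to the whole space makes translations available. The support lies in
  \<open>\<Omega>\<close>, and Borel measurability allows the change from the completed measure to
  \<open>lborel\<close>.\<close>

lemma test_function_integral_lborel:
  assumes "open \<Omega>" "g \<in> test_functions \<Omega>"
  shows "(LINT x|lebesgue_on \<Omega>. g x) = (LINT x|lborel. g x)"
proof -
  obtain K where K: "C_infinity_on UNIV g" "\<forall>x. x \<notin> K \<longrightarrow> g x = 0" "compact K" "K \<subseteq> \<Omega>"
    using test_functionsE[OF assms(2)] by blast
  have "(LINT x|lebesgue_on \<Omega>. g x) = (LINT x|lebesgue. indicator \<Omega> x *\<^sub>R g x)"
    using assms(1) by (intro integral_restrict_space) simp
  also have "\<dots> = (LINT x|lebesgue. g x)"
    by (rule Bochner_Integration.integral_cong) (use K(2,4) in \<open>auto simp: indicator_def\<close>)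
  also have "\<dots> = (LINT x|lborel. g x)"
    using test_function_borel[OF assms(2)] by (intro integral_completion) simp
  finally show ?thesis .
qed

section \<open>Integration by parts for test functions\<close>

lemma has_real_derivative_along_axis:
  fixes g :: "real ^ 'n::finite \<Rightarrow> real"
  assumes "g differentiable (at (x + t *\<^sub>R axis i 1))"
  shows "((\<lambda>s. g (x + s *\<^sub>R axis i 1)) has_real_derivative partial_deriv i g (x + t *\<^sub>R axis i 1)) (at t)"
proof -
  define D where "D = frechet_derivative g (at (x + t *\<^sub>R axis i 1))"
  have D: "(g has_derivative D) (at (x + t *\<^sub>R axis i 1))"
    unfolding D_def by (rule has_derivative_frechet[OF assms])
  have "((\<lambda>s. x + s *\<^sub>R axis i 1) has_derivative (\<lambda>s. s *\<^sub>R axis i 1)) (at t)"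
    by (auto intro!: derivative_eq_intros)
  from has_derivative_compose[OF this D]
  have "((\<lambda>s. g (x + s *\<^sub>R axis i 1)) has_derivative (\<lambda>s. D (s *\<^sub>R axis i 1))) (at t)" .
  moreover have "D (s *\<^sub>R axis i 1) = D (axis i 1) * s" for s
    using linear_scale[OF has_derivative_linear[OF D]] by (simp add: mult.commute)
  ultimately show ?thesis
    by (simp add: has_field_derivative_def partial_deriv_eq[OF D])
qed

text \<open>Translation invariance makes the integral of every difference quotient vanish.\<close>

lemma integral_partial_deriv_test_function:
  fixes \<Omega> :: "(real ^ 'n::finite) set"
  assumes "open \<Omega>" "g \<in> test_functions \<Omega>"
  shows "(LINT x|lebesgue_on \<Omega>. partial_deriv i g x) = 0"
proof -
  define e :: "real ^ 'n" where "e = axis i 1"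
  define t :: "nat \<Rightarrow> real" where "t n = inverse (real (Suc n))" for n
  have t: "0 < t n" "t n \<le> 1" for n by (auto simp: t_def divide_simps)
  have t0: "filterlim t (at 0) sequentially"
    unfolding filterlim_at using LIMSEQ_inverse_real_of_nat t(1)
    by (auto simp: t_def[abs_def] intro!: always_eventually)
  obtain K where K: "C_infinity_on UNIV g" "\<forall>x. x \<notin> K \<longrightarrow> g x = 0" "compact K" "K \<subseteq> \<Omega>"
    using test_functionsE[OF assms(2)] by blast
  obtain R where R: "\<And>x. x \<in> K \<Longrightarrow> norm x \<le> R"
    using compact_imp_bounded[OF K(3)] by (auto simp: bounded_iff)
  obtain C where C: "\<And>x. \<bar>partial_deriv i g x\<bar> \<le> C"
    using test_function_bounded[OF test_function_partial_deriv[OF assms(2)]] by blast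
  have C0: "0 \<le> C" using C[of 0] by linarith
  have borel: "g \<in> borel_measurable borel" by (rule test_function_borel[OF assms(2)])
  have intg: "integrable lborel g"
  proof -
    have "integrable lborel (\<lambda>x. indicator K x *\<^sub>R g x)"
      by (intro borel_integrable_compact K test_function_continuous[OF assms(2)])
    moreover have "(\<lambda>x. indicator K x *\<^sub>R g x) = g"
      using K(2) by (auto simp: indicator_def fun_eq_iff)
    ultimately show ?thesis by simp
  qed
  have transl: "integrable lborel (\<lambda>x. g (c + x))" "(LINT x|lborel. g (c + x)) = (LINT x|lborel. g x)" for c
  proof -
    have m: "(+) c \<in> measurable lborel borel" by simp
    show "integrable lborel (\<lambda>x. g (c + x))"
      using intg integrable_distr_eq[OF m borel] by (simp add: lborel_distr_plus)
    show "(LINT x|lborel. g (c + x)) = (LINT x|lborel. g x)"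
      using integral_distr[OF m borel] by (simp add: lborel_distr_plus)
  qed
  have lim: "(\<lambda>n. LINT x|lborel. (g (t n *\<^sub>R e + x) - g x) / t n) \<longlonglongrightarrow> (LINT x|lborel. partial_deriv i g x)"
  \<comment> \<open>The mean value theorem bounds the quotients by \<open>C\<close>. They vanish
    outside the ball of radius \<open>R + 1\<close>, because \<open>K\<close> lies in the ball of
    radius \<open>R\<close> and the shift has length \<open>t n\<close>, at most 1.\<close>
  proof (rule integral_dominated_convergence[where w = "\<lambda>x. C * indicator (cball 0 (R + 1)) x"])
    show "partial_deriv i g \<in> borel_measurable lborel"
      using test_function_borel[OF test_function_partial_deriv[OF assms(2)]] by simp
    show "(\<lambda>x. (g (t n *\<^sub>R e + x) - g x) / t n) \<in> borel_measurable lborel" for n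
      using borel by measurable
    show "integrable lborel (\<lambda>x :: real ^ 'n. C * indicator (cball 0 (R + 1)) x)"
      using emeasure_bounded_finite[of "cball (0 :: real ^ 'n) (R + 1)"]
      by (intro integrable_mult_right integrable_real_indicator) auto
    show "AE x in lborel. (\<lambda>n. (g (t n *\<^sub>R e + x) - g x) / t n) \<longlonglongrightarrow> partial_deriv i g x"
    proof (rule AE_I2)
      fix x
      have "((\<lambda>s. (g (x + s *\<^sub>R e) - g x) / s) \<longlongrightarrow> partial_deriv i g x) (at 0)"
        using has_real_derivative_along_axis[of g x 0 i] test_function_differentiable[OF assms(2)]
        by (simp add: has_field_derivative_iff e_def)
      from filterlim_compose[OF this t0]
      show "(\<lambda>n. (g (t n *\<^sub>R e + x) - g x) / t n) \<longlonglongrightarrow> partial_deriv i g x"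
        by (simp add: add.commute)
    qed
    show "AE x in lborel. norm ((g (t n *\<^sub>R e + x) - g x) / t n) \<le> C * indicator (cball 0 (R + 1)) x" for n
    proof (rule AE_I2)
      fix x
      show "norm ((g (t n *\<^sub>R e + x) - g x) / t n) \<le> C * indicator (cball 0 (R + 1)) x"
      proof (cases "x \<in> cball 0 (R + 1)")
        case True
        obtain z where "0 < z" "z < t n"
          "g (x + t n *\<^sub>R e) - g (x + 0 *\<^sub>R e) = (t n - 0) * partial_deriv i g (x + z *\<^sub>R e)"
          using MVT2[OF t(1)[of n], of "\<lambda>s. g (x + s *\<^sub>R e)" "\<lambda>s. partial_deriv i g (x + s *\<^sub>R e)"]
            has_real_derivative_along_axis test_function_differentiable[OF assms(2)]
          unfolding e_def by blast
        then show ?thesis using t(1)[of n] C True by (simp add: add.commute)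
      next
        case False
        have "norm e = 1" by (simp add: e_def norm_axis_1)
        then have "norm x \<le> norm (t n *\<^sub>R e + x) + t n"
          using norm_triangle_ineq4[of "t n *\<^sub>R e + x" "t n *\<^sub>R e"] t(1)[of n] by simp
        with False t(2)[of n] have "R < norm (t n *\<^sub>R e + x)" "R < norm x" by auto
        then have "t n *\<^sub>R e + x \<notin> K" "x \<notin> K" using R by force+
        then show ?thesis using K(2) C0 by simp
      qed
    qed
  qed
  have "(LINT x|lborel. (g (t n *\<^sub>R e + x) - g x) / t n) = 0" for n
    using transl[of "t n *\<^sub>R e"] intg by simp
  with lim have "(\<lambda>n. 0) \<longlonglongrightarrow> (LINT x|lborel. partial_deriv i g x)" by (simp only:)
  then have "(LINT x|lborel. partial_deriv i g x) = 0"
    using LIMSEQ_unique tendsto_const by blast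
  then show ?thesis
    using test_function_integral_lborel[OF assms(1) test_function_partial_deriv[OF assms(2)]] by simp
qed

lemma test_function_mult:
  "open \<Omega> \<Longrightarrow> f \<in> test_functions \<Omega> \<Longrightarrow> g \<in> test_functions \<Omega> \<Longrightarrow> (\<lambda>x. f x * g x) \<in> test_functions \<Omega>"
  by (intro test_function_mult_smooth test_function_C_infinity)

lemma test_function_integral_by_parts:
  assumes "open \<Omega>" "bounded \<Omega>" "f \<in> test_functions \<Omega>" "g \<in> test_functions \<Omega>"
  shows "(LINT x|lebesgue_on \<Omega>. f x * partial_deriv i g x) = - (LINT x|lebesgue_on \<Omega>. partial_deriv i f x * g x)"
proof -
  have "0 = (LINT x|lebesgue_on \<Omega>. partial_deriv i (\<lambda>x. f x * g x) x)"
    using integral_partial_deriv_test_function[OF assms(1) test_function_mult[OF assms(1,3,4)]] by simp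
  also have "\<dots> = (LINT x|lebesgue_on \<Omega>. f x * partial_deriv i g x + partial_deriv i f x * g x)"
    by (intro Bochner_Integration.integral_cong refl partial_deriv_mult test_function_differentiable[OF assms(3)]
        test_function_differentiable[OF assms(4)])
  also have "\<dots> = (LINT x|lebesgue_on \<Omega>. f x * partial_deriv i g x) + (LINT x|lebesgue_on \<Omega>. partial_deriv i f x * g x)"
    by (intro Bochner_Integration.integral_add test_function_integrable test_function_mult assms
        test_function_partial_deriv)
  finally show ?thesis by simp
qed

section \<open>Test functions as elements of the Sobolev space\<close>

lemma bounded_in_Lp_on:
  fixes g :: "real ^ 'n \<Rightarrow> 'b::{real_normed_vector, second_countable_topology}"
  assumes "open \<Omega>" "bounded \<Omega>" "g \<in> borel_measurable (lebesgue_on \<Omega>)"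
    and "\<And>x. norm (g x) \<le> C" "0 \<le> p"
  shows "g \<in> Lp_on p \<Omega>"
proof -
  have "integrable (lebesgue_on \<Omega>) (\<lambda>x. norm (g x) powr p)"
  proof (rule integrable_on_bounded_open[OF assms(1,2)])
    show "(\<lambda>x. norm (g x) powr p) \<in> borel_measurable (lebesgue_on \<Omega>)" using assms(3) by measurable
    show "\<bar>norm (g x) powr p\<bar> \<le> C powr p" for x
      using assms(4)[of x] assms(5) by (simp add: powr_mono2)
  qed
  then show ?thesis using assms(3) by (simp add: Lp_on_def)
qed

lemma test_function_gradient_bounded:
  assumes "g \<in> test_functions \<Omega>"
  obtains C where "\<And>x. norm (gradient g x) \<le> C"
proof -
  have "\<exists>C. \<forall>x. \<bar>partial_deriv i g x\<bar> \<le> C" for i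
    using test_function_bounded[OF test_function_partial_deriv[OF assms]] by metis
  then obtain C where C: "\<And>i x. \<bar>partial_deriv i g x\<bar> \<le> C i" by metis
  have "norm (gradient g x) \<le> (\<Sum>i\<in>UNIV. C i)" for x
  proof -
    have "norm (gradient g x) \<le> (\<Sum>i\<in>UNIV. \<bar>partial_deriv i g x\<bar>)"
      using norm_le_l1_cart[of "gradient g x"] by (simp add: gradient_def)
    also have "\<dots> \<le> (\<Sum>i\<in>UNIV. C i)" by (intro sum_mono C)
    finally show ?thesis .
  qed
  then show ?thesis using that by blast
qed

lemma test_function_gradient_borel:
  fixes g :: "real ^ 'n::finite \<Rightarrow> real"
  assumes "g \<in> test_functions \<Omega>"
  shows "gradient g \<in> borel_measurable borel"
proof (rule borel_measurable_continuous_onI)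
  show "continuous_on UNIV (gradient g)"
    unfolding gradient_def
    by (intro continuous_on_vec_lambda test_function_continuous[OF test_function_partial_deriv[OF assms]])
qed

lemma test_function_weak_gradient:
  assumes "open \<Omega>" "bounded \<Omega>" "g \<in> test_functions \<Omega>"
  shows "has_weak_gradient \<Omega> g (gradient g)"
proof -
  obtain C where "\<And>x. norm (g x) \<le> C" using test_function_bounded[OF assms(3)] by (metis real_norm_def)
  then have "g \<in> Lp_on 2 \<Omega>"
    by (intro bounded_in_Lp_on assms measurable_lebesgue_on_borel test_function_borel[OF assms(3)]) auto
  moreover obtain C' where "\<And>x. norm (gradient g x) \<le> C'" using test_function_gradient_bounded[OF assms(3)] by blast
  then have "gradient g \<in> Lp_on 2 \<Omega>"
    by (intro bounded_in_Lp_on assms measurable_lebesgue_on_borel test_function_gradient_borel[OF assms(3)]) auto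
  ultimately show ?thesis
    using test_function_integral_by_parts[OF assms] by (simp add: has_weak_gradient_def gradient_def)
qed

text \<open>This allows test functions to be inserted into the weak formulation. The approximating
  sequence is constant.\<close>

lemma test_function_in_H1_0:
  assumes "open \<Omega>" "bounded \<Omega>" "g \<in> test_functions \<Omega>"
  shows "g \<in> H1_0 \<Omega>"
  unfolding H1_0_def
  using test_function_weak_gradient[OF assms] assms(3)
  by (auto intro!: exI[of _ "gradient g"] exI[of _ "\<lambda>_. g"])

section \<open>Comparison with a subsolution\<close>

lemma integrable_mult_bounded:
  fixes g w :: "'a \<Rightarrow> real"
  assumes "integrable M g" "w \<in> borel_measurable M" "\<And>x. \<bar>w x\<bar> \<le> C"
  shows "integrable M (\<lambda>x. g x * w x)"
proof (rule Bochner_Integration.integrable_bound)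
  show "integrable M (\<lambda>x. C * g x)" using assms(1) by simp
  show "(\<lambda>x. g x * w x) \<in> borel_measurable M"
    using assms(1,2) by (intro borel_measurable_times borel_measurable_integrable[of M g])
  show "AE x in M. norm (g x * w x) \<le> norm (C * g x)"
  proof (rule AE_I2)
    fix x
    have "\<bar>w x\<bar> \<le> \<bar>C\<bar>" using assms(3)[of x] by linarith
    then have "\<bar>g x\<bar> * \<bar>w x\<bar> \<le> \<bar>g x\<bar> * \<bar>C\<bar>" by (rule mult_left_mono) simp
    then show "norm (g x * w x) \<le> norm (C * g x)" by (simp add: abs_mult mult.commute)
  qed
qed

text \<open>On a set of finite measure, 1 + |g|^p is an integrable majorant of |g| as p >=
  1.\<close>

lemma Lp_on_integrable:
  fixes g :: "real ^ 'n \<Rightarrow> 'b::{banach, second_countable_topology}"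
  assumes "open \<Omega>" "bounded \<Omega>" "g \<in> Lp_on p \<Omega>" "1 \<le> p"
  shows "integrable (lebesgue_on \<Omega>) g"
proof (rule Bochner_Integration.integrable_bound)
  show "integrable (lebesgue_on \<Omega>) (\<lambda>x. 1 + norm (g x) powr p)"
    using assms(3) finite_measure.integrable_const[OF bounded_open_finite_measure[OF assms(1,2)]]
    unfolding Lp_on_def by (intro Bochner_Integration.integrable_add) auto
  show "g \<in> borel_measurable (lebesgue_on \<Omega>)" using assms(3) by (simp add: Lp_on_def)
  show "AE x in lebesgue_on \<Omega>. norm (g x) \<le> norm (1 + norm (g x) powr p)"
  proof (rule AE_I2)
    fix x
    have "norm (g x) \<le> 1 + norm (g x) powr p"
    proof (cases "norm (g x) \<le> 1")
      case True
      then show ?thesis by (smt (verit) powr_ge_zero)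
    next
      case False
      then have "norm (g x) powr 1 \<le> norm (g x) powr p" using assms(4) by (intro powr_mono) auto
      then show ?thesis using False by simp
    qed
    then show "norm (g x) \<le> norm (1 + norm (g x) powr p)" by simp
  qed
qed

text \<open>Needed to split the squared H^1 distance into its two terms. The integral of a
  nonintegrable function is 0 by convention, so convergence of such integrals to 0 carries
  information only together with integrability.\<close>

lemma Lp_on_2_integrable_diff:
  fixes f g :: "real ^ 'n \<Rightarrow> 'b::{banach, second_countable_topology}"
  assumes "f \<in> Lp_on 2 \<Omega>" "g \<in> Lp_on 2 \<Omega>"
  shows "integrable (lebesgue_on \<Omega>) (\<lambda>x. (norm (f x - g x))\<^sup>2)"
proof (rule Bochner_Integration.integrable_bound)
  show "integrable (lebesgue_on \<Omega>) (\<lambda>x. 2 * norm (f x) powr 2 + 2 * norm (g x) powr 2)"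
    using assms by (simp add: Lp_on_def)
  show "(\<lambda>x. (norm (f x - g x))\<^sup>2) \<in> borel_measurable (lebesgue_on \<Omega>)"
    using assms by (intro borel_measurable_power borel_measurable_norm borel_measurable_diff)
      (auto simp: Lp_on_def)
  show "AE x in lebesgue_on \<Omega>. norm ((norm (f x - g x))\<^sup>2) \<le> norm (2 * norm (f x) powr 2 + 2 * norm (g x) powr 2)"
  proof (rule AE_I2)
    fix x
    have "(norm (f x - g x))\<^sup>2 \<le> (norm (f x) + norm (g x))\<^sup>2"
      by (intro power_mono norm_triangle_ineq4) simp
    also have "\<dots> \<le> 2 * (norm (f x))\<^sup>2 + 2 * (norm (g x))\<^sup>2"
      using zero_le_power2[of "norm (f x) - norm (g x)"] by (simp add: power2_eq_square algebra_simps)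
    finally show "norm ((norm (f x - g x))\<^sup>2) \<le> norm (2 * norm (f x) powr 2 + 2 * norm (g x) powr 2)"
      by simp
  qed
qed

lemma weak_gradient_times_test_function_integrable:
  assumes "open \<Omega>" "bounded \<Omega>" "has_weak_gradient \<Omega> u U" "g \<in> test_functions \<Omega>"
  shows "integrable (lebesgue_on \<Omega>) (\<lambda>x. U x $ i * g x)"
proof -
  have "integrable (lebesgue_on \<Omega>) U"
    using assms by (intro Lp_on_integrable[of _ _ 2]) (auto simp: has_weak_gradient_def)
  then have "integrable (lebesgue_on \<Omega>) (\<lambda>x. U x $ i)"
    by (rule integrable_bounded_linear[OF bounded_linear_vec_nth])
  moreover obtain C where "\<And>x. \<bar>g x\<bar> \<le> C" using test_function_bounded[OF assms(4)] by blast
  ultimately show ?thesis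
    by (intro integrable_mult_bounded measurable_lebesgue_on_borel test_function_borel[OF assms(4)])
qed

text \<open>With the component of \<open>\<xi>\<close> isolated, the remaining factor will be a test
  function, and this is what a weak gradient can be tested with.\<close>

lemma matrix_vector_inner_gradient:
  "(A *v \<xi>) \<bullet> gradient g x = (\<Sum>i\<in>UNIV. \<Sum>j\<in>UNIV. \<xi> $ j * (A $ i $ j * partial_deriv i g x))"
  by (simp add: inner_vec_def matrix_vector_mult_def gradient_def sum_distrib_right sum_distrib_left mult_ac)

lemma norm_matrix_vector_mult_le:
  fixes A :: "real ^ 'n ^ 'm"
  assumes "\<And>i j. \<bar>A $ i $ j\<bar> \<le> S"
  shows "norm (A *v \<xi>) \<le> real (CARD('m) * CARD('n)) * S * norm \<xi>"
proof -
  have "norm (A *v \<xi>) \<le> (\<Sum>i\<in>UNIV. \<bar>(A *v \<xi>) $ i\<bar>)" by (rule norm_le_l1_cart)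
  also have "\<dots> \<le> (\<Sum>i::'m\<in>UNIV. \<Sum>j::'n\<in>UNIV. S * norm \<xi>)"
  proof (rule sum_mono)
    fix i
    have "\<bar>(A *v \<xi>) $ i\<bar> \<le> (\<Sum>j\<in>UNIV. \<bar>A $ i $ j * \<xi> $ j\<bar>)"
      unfolding matrix_vector_mult_def by (simp add: sum_abs)
    also have "\<dots> \<le> (\<Sum>j::'n\<in>UNIV. S * norm \<xi>)"
      unfolding abs_mult
      by (intro sum_mono mult_mono assms component_le_norm_cart)
         (use assms order_trans[OF abs_ge_zero] in auto)
    finally show "\<bar>(A *v \<xi>) $ i\<bar> \<le> (\<Sum>j::'n\<in>UNIV. S * norm \<xi>)" .
  qed
  finally show ?thesis by simp
qed

section \<open>Integrals of the flux\<close>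

context
  fixes \<Omega> :: "(real ^ 'n::finite) set" and \<sigma> :: "real ^ 'n \<Rightarrow> real ^ 'n ^ 'n"
  assumes \<Omega>: "open \<Omega>" "bounded \<Omega>"
    and \<sigma>: "\<And>i j. C_infinity_on \<Omega> (\<lambda>x. \<sigma> x $ i $ j)"
begin

text \<open>The indices are independent because both uses occur: \<open>k = i\<close>, when the
  coefficient is moved onto the test function, and \<open>k = j\<close>, for the flux of a smooth
  function.\<close>

lemma flux_test_function:
  assumes "g \<in> test_functions \<Omega>"
  shows "(\<lambda>x. \<sigma> x $ i $ j * partial_deriv k g x) \<in> test_functions \<Omega>"
  by (rule test_function_mult_smooth[OF \<Omega>(1) \<sigma> test_function_partial_deriv[OF assms]])

lemma flux_integrable:
  assumes "has_weak_gradient \<Omega> u U" "g \<in> test_functions \<Omega>"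
  shows "integrable (lebesgue_on \<Omega>) (\<lambda>x. (\<sigma> x *v U x) \<bullet> gradient g x)"
  unfolding matrix_vector_inner_gradient
  by (intro Bochner_Integration.integrable_sum
      weak_gradient_times_test_function_integrable[OF \<Omega> assms(1) flux_test_function[OF assms(2)]])

text \<open>Since \<open>U\<close> does not occur on the right-hand side, the weak gradient in the equation for \<open>u\<close> may be
  exchanged for the limit of the gradients of the approximating test functions.\<close>

lemma flux_integral:
  assumes "has_weak_gradient \<Omega> u U" "g \<in> test_functions \<Omega>"
  shows "(LINT x|lebesgue_on \<Omega>. (\<sigma> x *v U x) \<bullet> gradient g x) =
    - (\<Sum>i\<in>UNIV. \<Sum>j\<in>UNIV. LINT x|lebesgue_on \<Omega>. u x * partial_deriv j (\<lambda>x. \<sigma> x $ i $ j * partial_deriv i g x) x)"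
proof -
  have int: "integrable (lebesgue_on \<Omega>) (\<lambda>x. U x $ j * (\<sigma> x $ i $ j * partial_deriv i g x))" for i j
    by (rule weak_gradient_times_test_function_integrable[OF \<Omega> assms(1) flux_test_function[OF assms(2)]])
  have "(LINT x|lebesgue_on \<Omega>. u x * partial_deriv j (\<lambda>x. \<sigma> x $ i $ j * partial_deriv i g x) x) =
      - (LINT x|lebesgue_on \<Omega>. U x $ j * (\<sigma> x $ i $ j * partial_deriv i g x))" for i j
    using assms(1) flux_test_function[OF assms(2)] unfolding has_weak_gradient_def by blast
  then show ?thesis
    unfolding matrix_vector_inner_gradient
    by (simp add: Bochner_Integration.integral_sum Bochner_Integration.integrable_sum int sum_negf)
qed

text \<open>For smooth \<open>w\<close> the derivative is moved the other way, off \<open>g\<close>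
  and onto the flux, since the subsolution condition is stated pointwise in terms of the
  divergence.\<close>

lemma flux_integral_by_parts:
  assumes "w \<in> test_functions \<Omega>" "g \<in> test_functions \<Omega>"
  shows "(LINT x|lebesgue_on \<Omega>. (\<sigma> x *v gradient w x) \<bullet> gradient g x) =
    - (LINT x|lebesgue_on \<Omega>. (\<Sum>i\<in>UNIV. \<Sum>j\<in>UNIV. partial_deriv i (\<lambda>x. \<sigma> x $ i $ j * partial_deriv j w x) x) * g x)"
proof -
  have eq: "(\<sigma> x *v gradient w x) \<bullet> gradient g x =
      (\<Sum>i\<in>UNIV. \<Sum>j\<in>UNIV. (\<sigma> x $ i $ j * partial_deriv j w x) * partial_deriv i g x)" for x
    unfolding matrix_vector_inner_gradient by (simp add: gradient_def mult_ac)
  have int: "integrable (lebesgue_on \<Omega>) (\<lambda>x. (\<sigma> x $ i $ j * partial_deriv j w x) * partial_deriv i g x)"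
    "integrable (lebesgue_on \<Omega>) (\<lambda>x. partial_deriv i (\<lambda>x. \<sigma> x $ i $ j * partial_deriv j w x) x * g x)" for i j
    by (intro test_function_integrable \<Omega> test_function_mult flux_test_function test_function_partial_deriv assms)+
  have "(LINT x|lebesgue_on \<Omega>. (\<sigma> x $ i $ j * partial_deriv j w x) * partial_deriv i g x) =
      - (LINT x|lebesgue_on \<Omega>. partial_deriv i (\<lambda>x. \<sigma> x $ i $ j * partial_deriv j w x) x * g x)" for i j
    by (rule test_function_integral_by_parts[OF \<Omega> flux_test_function[OF assms(1)] assms(2)])
  then show ?thesis
    unfolding eq sum_distrib_right
    by (simp only: Bochner_Integration.integral_sum Bochner_Integration.integrable_sum int sum_negf)
qed

end

text \<open>Outside both compact sets the argument is 0, where \<open>bump 0\<close> vanishes; so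
  their union carries the support.\<close>

lemma test_function_bump:
  assumes "w \<in> test_functions \<Omega>" "g \<in> test_functions \<Omega>"
  shows "(\<lambda>x. bump 0 (w x - g x)) \<in> test_functions \<Omega>"
proof -
  obtain K where K: "C_infinity_on UNIV w" "\<forall>x. x \<notin> K \<longrightarrow> w x = 0" "compact K" "K \<subseteq> \<Omega>"
    using test_functionsE[OF assms(1)] by blast
  obtain L where L: "C_infinity_on UNIV g" "\<forall>x. x \<notin> L \<longrightarrow> g x = 0" "compact L" "L \<subseteq> \<Omega>"
    using test_functionsE[OF assms(2)] by blast
  have "C_infinity_on UNIV (\<lambda>x. w x + (- 1) * g x)"
    by (intro C_infinity_on_add C_infinity_on_mult K L open_UNIV C_infinity_on_const)
  then have "C_infinity_on UNIV (\<lambda>x. bump 0 (w x - g x))"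
    by (intro C_infinity_on_bump) auto
  then show ?thesis
  proof (rule test_functionsI)
    show "{x. bump 0 (w x - g x) \<noteq> 0} \<subseteq> K \<union> L"
      using K(2) L(2) bump_nonpos[of 0 0] by auto
  qed (use K L in auto)
qed

lemma gradient_bump:
  assumes "w \<in> test_functions \<Omega>" "g \<in> test_functions \<Omega>"
  shows "gradient (\<lambda>x. bump 0 (w x - g x)) x = bump (Suc 0) (w x - g x) *\<^sub>R (gradient w x - gradient g x)"
proof -
  have d: "((\<lambda>x. w x - g x) has_derivative
      (\<lambda>v. frechet_derivative w (at x) v - frechet_derivative g (at x) v)) (at x)"
    by (intro has_derivative_diff has_derivative_frechet test_function_differentiable[OF assms(1)]
        test_function_differentiable[OF assms(2)])
  then have "partial_deriv i (\<lambda>x. bump 0 (w x - g x)) x =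
      bump (Suc 0) (w x - g x) * partial_deriv i (\<lambda>x. w x - g x) x" for i
    by (intro partial_deriv_compose[OF bump_has_derivative]) (auto simp: differentiable_def)
  then show ?thesis
    by (simp add: gradient_def vec_eq_iff partial_deriv_eq[OF d]) (simp add: partial_deriv_def)
qed

text \<open>The strict gap \<open>c\<close> closes the argument: once the gradient terms are
  handled, 0 <= integral of \<open>F x * b x\<close> <= -c times the integral of \<open>b\<close>,
  which forces \<open>b\<close> to vanish almost everywhere.\<close>

lemma weak_solution_comparison:
  fixes \<Omega> :: "(real ^ 'n::finite) set" and \<sigma> :: "real ^ 'n \<Rightarrow> real ^ 'n ^ 'n"
  assumes \<Omega>: "open \<Omega>" "bounded \<Omega>"
    and \<sigma>: "\<And>i j. C_infinity_on \<Omega> (\<lambda>x. \<sigma> x $ i $ j)"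
    and S: "\<And>i j x. x \<in> \<Omega> \<Longrightarrow> \<bar>\<sigma> x $ i $ j\<bar> \<le> S"
    and ell: "0 < lam" "AE x in lebesgue_on \<Omega>. \<forall>\<xi>. lam * (norm \<xi>)\<^sup>2 \<le> (\<sigma> x *v \<xi>) \<bullet> \<xi>"
    and f: "integrable (lebesgue_on \<Omega>) f"
    and q: "q \<in> admissible \<Omega> qlo qhi" "0 \<le> qlo" and m: "odd m"
    and W: "W \<in> test_functions \<Omega>"
    and c: "0 < c"
    and sub: "AE x in lebesgue_on \<Omega>.
      - (\<Sum>i\<in>UNIV. \<Sum>j\<in>UNIV. partial_deriv i (\<lambda>x. \<sigma> x $ i $ j * partial_deriv j W x) x)
        + q x * W x ^ m - f x \<le> - c"
    and u: "weak_solution \<Omega> \<sigma> m f q u"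
    and x: "x \<in> \<Omega>"
  shows "W x \<le> u x"
proof -
  let ?M = "lebesgue_on \<Omega>"
  define divW where
    "divW x = (\<Sum>i\<in>UNIV. \<Sum>j\<in>UNIV. partial_deriv i (\<lambda>x. \<sigma> x $ i $ j * partial_deriv j W x) x)" for x
  obtain U where U: "u \<in> H1_0 \<Omega>" "continuous_on (closure \<Omega>) u" "has_weak_gradient \<Omega> u U"
    and eq: "\<And>v V. v \<in> H1_0 \<Omega> \<Longrightarrow> has_weak_gradient \<Omega> v V \<Longrightarrow>
      (LINT x|?M. (\<sigma> x *v U x) \<bullet> V x) + (LINT x|?M. q x * u x ^ m * v x) = (LINT x|?M. f x * v x)"
    using u unfolding weak_solution_def by blast
  obtain U' \<phi> where U': "has_weak_gradient \<Omega> u U'" and \<phi>: "\<And>k::nat. \<phi> k \<in> test_functions \<Omega>"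
    and lim: "(\<lambda>k. LINT x|?M. (\<phi> k x - u x)\<^sup>2 + (norm (gradient (\<phi> k) x - U' x))\<^sup>2) \<longlonglongrightarrow> 0"
    using U(1) unfolding H1_0_def by blast

  have int_u: "integrable ?M (\<lambda>x. (\<phi> k x - u x)\<^sup>2)" for k
  proof -
    have "\<phi> k \<in> Lp_on 2 \<Omega>" "u \<in> Lp_on 2 \<Omega>"
      using test_function_weak_gradient[OF \<Omega> \<phi>] U' by (simp_all add: has_weak_gradient_def)
    from Lp_on_2_integrable_diff[OF this] show ?thesis by simp
  qed
  have int_U: "integrable ?M (\<lambda>x. (norm (gradient (\<phi> k) x - U' x))\<^sup>2)" for k
    using test_function_weak_gradient[OF \<Omega> \<phi>] U'
    by (intro Lp_on_2_integrable_diff) (simp_all add: has_weak_gradient_def)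
  have lim_sum: "(\<lambda>k. (LINT x|?M. (\<phi> k x - u x)\<^sup>2) + (LINT x|?M. (norm (gradient (\<phi> k) x - U' x))\<^sup>2)) \<longlonglongrightarrow> 0"
    using lim by (simp add: Bochner_Integration.integral_add int_u int_U)
  have nn: "0 \<le> (LINT x|?M. (\<phi> k x - u x)\<^sup>2)" "0 \<le> (LINT x|?M. (norm (gradient (\<phi> k) x - U' x))\<^sup>2)" for k
    by simp_all
  have lim_u: "(\<lambda>k. LINT x|?M. (\<phi> k x - u x)\<^sup>2) \<longlonglongrightarrow> 0"
    by (rule tendsto_sandwich[OF _ _ tendsto_const lim_sum]) (use nn in \<open>auto intro!: always_eventually\<close>)
  have lim_U: "(\<lambda>k. LINT x|?M. (norm (gradient (\<phi> k) x - U' x))\<^sup>2) \<longlonglongrightarrow> 0"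
    by (rule tendsto_sandwich[OF _ _ tendsto_const lim_sum]) (use nn in \<open>auto intro!: always_eventually\<close>)

  have u_meas: "u \<in> borel_measurable ?M"
    using U(3) by (simp add: has_weak_gradient_def Lp_on_def)
  have q_meas: "q \<in> borel_measurable ?M" and q_bounds: "AE x in ?M. qlo \<le> q x \<and> q x \<le> qhi"
    using q(1) by (auto simp: admissible_def Linf_on_def)
  have int_qu: "integrable ?M (\<lambda>x. q x * u x ^ m)"
  proof -
    have "bounded (u ` closure \<Omega>)"
      using U(2) \<Omega>(2) by (intro compact_imp_bounded compact_continuous_image) (simp_all add: compact_closure)
    then obtain B where B: "\<And>x. x \<in> closure \<Omega> \<Longrightarrow> \<bar>u x\<bar> \<le> B"
      by (auto simp: bounded_iff)
    show ?thesis
    proof (rule finite_measure.integrable_const_bound[OF bounded_open_finite_measure[OF \<Omega>]])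
      show "AE x in ?M. norm (q x * u x ^ m) \<le> qhi * B ^ m"
        using q_bounds
      proof (rule AE_mp, intro AE_I2 impI)
        fix x assume x: "x \<in> space ?M" and qx: "qlo \<le> q x \<and> q x \<le> qhi"
        have "\<bar>u x\<bar> \<le> B" using B x closure_subset[of \<Omega>] by auto
        then have "\<bar>u x\<bar> ^ m \<le> B ^ m" by (intro power_mono) auto
        then show "norm (q x * u x ^ m) \<le> qhi * B ^ m"
          using qx q(2) by (auto simp: abs_mult power_abs intro!: mult_mono)
      qed
      show "(\<lambda>x. q x * u x ^ m) \<in> borel_measurable ?M"
        using u_meas q_meas by (intro borel_measurable_times borel_measurable_power)
    qed
  qed
  have int_div: "integrable ?M divW"
    unfolding divW_def[abs_def]
    by (intro Bochner_Integration.integrable_sum test_function_integrable \<Omega> test_function_partial_deriv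
        flux_test_function[OF \<Omega> \<sigma>] W)
  \<comment> \<open>The zero-order term is formed with \<open>u\<close>, not with \<open>W\<close>,
    so that \<open>tested\<close> below is an exact identity. The power of \<open>u\<close> is
    replaced by that of \<open>W\<close> only where \<open>W\<close> exceeds \<open>u\<close>, by
    monotonicity of odd powers.\<close>
  define F where "F x = - divW x + q x * u x ^ m - f x" for x
  have int_F: "integrable ?M F"
    unfolding F_def[abs_def]
    by (intro Bochner_Integration.integrable_diff Bochner_Integration.integrable_add
        Bochner_Integration.integrable_minus int_div int_qu f)

  define v where "v k x = bump 0 (W x - \<phi> k x)" for k x
  have v: "v k \<in> test_functions \<Omega>" for k
    unfolding v_def[abs_def] by (rule test_function_bump[OF W \<phi>])
  have v_meas: "v k \<in> borel_measurable ?M" for k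
    by (rule measurable_lebesgue_on_borel[OF test_function_borel[OF v]])
  have v_le: "\<bar>v k x\<bar> \<le> 1" for k x using bump_0_bounds by (simp add: v_def)
  have int_v: "integrable ?M (\<lambda>x. g x * v k x)" if "integrable ?M g" for g k
    by (rule integrable_mult_bounded[OF that v_meas v_le])
  have W': "has_weak_gradient \<Omega> W (gradient W)" by (rule test_function_weak_gradient[OF \<Omega> W])
  have tested: "(LINT x|?M. (\<sigma> x *v (gradient W x - U' x)) \<bullet> gradient (v k) x) = (LINT x|?M. F x * v k x)" for k
  proof -
    have "(LINT x|?M. (\<sigma> x *v (gradient W x - U' x)) \<bullet> gradient (v k) x) =
        (LINT x|?M. (\<sigma> x *v gradient W x) \<bullet> gradient (v k) x) - (LINT x|?M. (\<sigma> x *v U' x) \<bullet> gradient (v k) x)"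
      unfolding matrix_vector_mult_diff_distrib inner_diff_left
      by (intro Bochner_Integration.integral_diff flux_integrable[OF \<Omega> \<sigma> W' v] flux_integrable[OF \<Omega> \<sigma> U' v])
    \<comment> \<open>The equation is given with \<open>U\<close>, whereas the approximation refers
      to \<open>U'\<close>. Both flux integrals equal the same expression in \<open>u\<close> and
      the test function.\<close>
    also have "(LINT x|?M. (\<sigma> x *v U' x) \<bullet> gradient (v k) x) = (LINT x|?M. (\<sigma> x *v U x) \<bullet> gradient (v k) x)"
      by (simp only: flux_integral[OF \<Omega> \<sigma> U' v] flux_integral[OF \<Omega> \<sigma> U(3) v])
    also have "\<dots> = (LINT x|?M. f x * v k x) - (LINT x|?M. q x * u x ^ m * v k x)"
      using eq[OF test_function_in_H1_0[OF \<Omega> v] test_function_weak_gradient[OF \<Omega> v]] by (simp add: algebra_simps)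
    also have "(LINT x|?M. (\<sigma> x *v gradient W x) \<bullet> gradient (v k) x) = - (LINT x|?M. divW x * v k x)"
      unfolding divW_def by (rule flux_integral_by_parts[OF \<Omega> \<sigma> W v])
    also have "- (LINT x|?M. divW x * v k x) - ((LINT x|?M. f x * v k x) - (LINT x|?M. q x * u x ^ m * v k x)) =
        (LINT x|?M. F x * v k x)"
      unfolding F_def ring_distribs left_diff_distrib
      by (simp add: Bochner_Integration.integral_diff Bochner_Integration.integral_add int_v[OF int_div]
          int_v[OF int_qu] int_v[OF f])
    finally show ?thesis .
  qed

  \<comment> \<open>The error made by replacing \<open>U'\<close> by the gradient of \<open>\<phi> k\<close> is absorbed by ellipticity.\<close>
  obtain D where D: "D > 0" "\<And>t. \<bar>bump (Suc 0) t\<bar> \<le> D" using bump_bounded by blast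
  define N where "N = real (CARD('n) * CARD('n)) * S"
  \<comment> \<open>\<open>N\<^sup>2 / (4 * lam)\<close> is the remainder from completing the square
    below, and \<open>D\<close> bounds the factor that the derivative of the bump
    contributes.\<close>
  define C where "C = D * (N\<^sup>2 / (4 * lam))"
  have C0: "C \<ge> 0" using D ell(1) by (simp add: C_def)
  have lower: "- C * (LINT x|?M. (norm (gradient (\<phi> k) x - U' x))\<^sup>2) \<le> (LINT x|?M. F x * v k x)" for k
  proof -
    have "(LINT x|?M. - C * (norm (gradient (\<phi> k) x - U' x))\<^sup>2)
        \<le> (LINT x|?M. (\<sigma> x *v (gradient W x - U' x)) \<bullet> gradient (v k) x)"
    proof (rule integral_mono_AE)
      show "integrable ?M (\<lambda>x. - C * (norm (gradient (\<phi> k) x - U' x))\<^sup>2)"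
        by (intro integrable_mult_right int_U)
      show "integrable ?M (\<lambda>x. (\<sigma> x *v (gradient W x - U' x)) \<bullet> gradient (v k) x)"
        unfolding matrix_vector_mult_diff_distrib inner_diff_left
        by (intro Bochner_Integration.integrable_diff flux_integrable[OF \<Omega> \<sigma> W' v]
            flux_integrable[OF \<Omega> \<sigma> U' v])
      show "AE x in ?M. - C * (norm (gradient (\<phi> k) x - U' x))\<^sup>2
          \<le> (\<sigma> x *v (gradient W x - U' x)) \<bullet> gradient (v k) x"
        using ell(2)
      proof (rule AE_mp, intro AE_I2 impI)
        fix x assume "x \<in> space ?M" and ellx: "\<forall>\<xi>. lam * (norm \<xi>)\<^sup>2 \<le> (\<sigma> x *v \<xi>) \<bullet> \<xi>"
        then have x: "x \<in> \<Omega>" by simp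
        \<comment> \<open>\<open>a - e\<close> is the gradient difference in \<open>tested\<close>,
          while the gradient of \<open>v k\<close> is a nonnegative multiple of \<open>a\<close>.
          The part quadratic in \<open>a\<close> is controlled by ellipticity, so only the cross
          term with \<open>e\<close>, which tends to 0 in the L^2 norm, has to be absorbed.\<close>
        define a where "a = gradient W x - gradient (\<phi> k) x"
        define e where "e = U' x - gradient (\<phi> k) x"
        define b where "b = bump (Suc 0) (W x - \<phi> k x)"
        have b: "0 \<le> b" "b \<le> D" using bump_1_nonneg D(2)[of "W x - \<phi> k x"] by (auto simp: b_def)
        have "(\<sigma> x *v e) \<bullet> a \<le> norm (\<sigma> x *v e) * norm a" by (rule norm_cauchy_schwarz)
        also have "\<dots> \<le> N * norm e * norm a"
          unfolding N_def by (intro mult_right_mono norm_matrix_vector_mult_le S x) simp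
        finally have 1: "(\<sigma> x *v e) \<bullet> a \<le> N * norm e * norm a" .
        have "0 \<le> lam * (norm a - N * norm e / (2 * lam))\<^sup>2" using ell(1) by simp
        also have "\<dots> = lam * (norm a)\<^sup>2 - N * norm e * norm a + N\<^sup>2 / (4 * lam) * (norm e)\<^sup>2"
          using ell(1) by (simp add: power2_eq_square field_simps)
        also have "\<dots> \<le> (\<sigma> x *v a) \<bullet> a - (\<sigma> x *v e) \<bullet> a + N\<^sup>2 / (4 * lam) * (norm e)\<^sup>2"
          using ellx[rule_format, of a] 1 by linarith
        finally have 2: "- (N\<^sup>2 / (4 * lam) * (norm e)\<^sup>2) \<le> (\<sigma> x *v (a - e)) \<bullet> a"
          by (simp add: matrix_vector_mult_diff_distrib inner_diff_left)
        have "- C * (norm e)\<^sup>2 = D * - (N\<^sup>2 / (4 * lam) * (norm e)\<^sup>2)" by (simp add: C_def)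
        also have "\<dots> \<le> b * - (N\<^sup>2 / (4 * lam) * (norm e)\<^sup>2)"
          using b ell(1) by (intro mult_right_mono_neg) auto
        also have "\<dots> \<le> b * ((\<sigma> x *v (a - e)) \<bullet> a)" using 2 b(1) by (rule mult_left_mono)
        also have "\<dots> = (\<sigma> x *v (gradient W x - U' x)) \<bullet> gradient (v k) x"
          unfolding v_def[abs_def] gradient_bump[OF W \<phi>] by (simp add: a_def e_def b_def)
        finally show "- C * (norm (gradient (\<phi> k) x - U' x))\<^sup>2
            \<le> (\<sigma> x *v (gradient W x - U' x)) \<bullet> gradient (v k) x"
          by (simp add: e_def norm_minus_commute)
      qed
    qed
    then show ?thesis by (simp add: tested)
  qed

  \<comment> \<open>L^1 convergence gives pointwise convergence almost everywhere only along a
    subsequence. This is enough, as \<open>lower\<close> holds for every index.\<close>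
  obtain s where s: "strict_mono s" "AE x in ?M. (\<lambda>k. (\<phi> (s k) x - u x)\<^sup>2) \<longlonglongrightarrow> 0"
    using tendsto_L1_AE_subseq[of ?M "\<lambda>k x. (\<phi> k x - u x)\<^sup>2"] int_u lim_u by auto
  define b where "b x = bump 0 (W x - u x)" for x
  have b01: "0 \<le> b x" "\<bar>b x\<bar> \<le> 1" for x by (simp_all add: b_def bump_0_bounds)
  have bump_cont: "isCont (bump 0) t" for t
    using bump_has_derivative DERIV_isCont by blast
  then have bump_meas: "bump 0 \<in> borel_measurable borel"
    by (intro borel_measurable_continuous_onI continuous_at_imp_continuous_on) auto
  have b_meas: "b \<in> borel_measurable ?M"
    unfolding b_def[abs_def]
    by (intro measurable_compose[OF _ bump_meas] borel_measurable_diff u_meas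
        measurable_lebesgue_on_borel[OF test_function_borel[OF W]])
  have int_Fb: "integrable ?M (\<lambda>x. F x * b x)"
    by (rule integrable_mult_bounded[OF int_F b_meas b01(2)])
  have int_b: "integrable ?M b"
    using integrable_mult_bounded[OF finite_measure.integrable_const[OF bounded_open_finite_measure[OF \<Omega>]] b_meas b01(2), of 1]
    by simp
  have "(\<lambda>k. LINT x|?M. F x * v (s k) x) \<longlonglongrightarrow> (LINT x|?M. F x * b x)"
  proof (rule integral_dominated_convergence[where w = "\<lambda>x. \<bar>F x\<bar>"])
    show "(\<lambda>x. F x * b x) \<in> borel_measurable ?M" by (rule borel_measurable_integrable[OF int_Fb])
    show "(\<lambda>x. F x * v (s k) x) \<in> borel_measurable ?M" for k
      by (rule borel_measurable_integrable[OF int_v[OF int_F]])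
    show "integrable ?M (\<lambda>x. \<bar>F x\<bar>)" using int_F by simp
    show "AE x in ?M. norm (F x * v (s k) x) \<le> \<bar>F x\<bar>" for k
      using v_le by (auto simp: abs_mult intro!: mult_left_le)
    show "AE x in ?M. (\<lambda>k. F x * v (s k) x) \<longlonglongrightarrow> F x * b x"
      using s(2)
    proof (rule AE_mp, intro AE_I2 impI)
      fix x assume "(\<lambda>k. (\<phi> (s k) x - u x)\<^sup>2) \<longlonglongrightarrow> 0"
      then have "(\<lambda>k. sqrt ((\<phi> (s k) x - u x)\<^sup>2)) \<longlonglongrightarrow> sqrt 0" by (rule tendsto_real_sqrt)
      then have "(\<lambda>k. \<phi> (s k) x - u x) \<longlonglongrightarrow> 0" by (simp add: tendsto_rabs_zero_iff)
      then have "(\<lambda>k. W x - \<phi> (s k) x) \<longlonglongrightarrow> W x - u x"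
        by (intro tendsto_diff tendsto_const) (simp add: LIM_zero_iff)
      then show "(\<lambda>k. F x * v (s k) x) \<longlonglongrightarrow> F x * b x"
        unfolding v_def b_def by (intro tendsto_mult tendsto_const isCont_tendsto_compose[OF bump_cont])
    qed
  qed
  moreover have "(\<lambda>k. - C * (LINT x|?M. (norm (gradient (\<phi> (s k)) x - U' x))\<^sup>2)) \<longlonglongrightarrow> - C * 0"
    using LIMSEQ_subseq_LIMSEQ[OF lim_U s(1)] by (intro tendsto_mult tendsto_const) (simp add: o_def)
  ultimately have "- C * 0 \<le> (LINT x|?M. F x * b x)"
    using lower by (intro LIMSEQ_le) auto
  also have "(LINT x|?M. F x * b x) \<le> (LINT x|?M. - c * b x)"
  proof (rule integral_mono_AE[OF int_Fb])
    show "integrable ?M (\<lambda>x. - c * b x)" using int_b by simp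
    show "AE x in ?M. F x * b x \<le> - c * b x"
      using sub q_bounds
    proof (eventually_elim)
      case (elim x)
      show "F x * b x \<le> - c * b x"
      proof (cases "W x \<le> u x")
        case True
        then show ?thesis by (simp add: b_def bump_nonpos)
      next
        case False
        then have "q x * u x ^ m \<le> q x * W x ^ m"
          using elim(2) q(2) m by (intro mult_left_mono power_mono_odd) auto
        with elim(1) have "F x \<le> - c" by (simp add: F_def divW_def)
        then show ?thesis by (intro mult_right_mono) (simp_all add: b_def bump_0_bounds)
      qed
    qed
  qed
  finally have "c * (LINT x|?M. b x) \<le> 0" by simp
  then have "(LINT x|?M. b x) \<le> 0" using c by (simp add: mult_le_0_iff)
  moreover have "0 \<le> (LINT x|?M. b x)" by (simp add: b_def bump_0_bounds)
  ultimately have "(LINT x|?M. b x) = 0" by linarith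
  then have "AE x in ?M. b x = 0"
    by (subst (asm) integral_nonneg_eq_0_iff_AE[OF int_b]) (auto simp: b_def bump_0_bounds)
  then have "AE x in ?M. W x \<le> u x"
    by (rule AE_mp) (auto simp: b_def bump_0 split: if_splits)
  then have ae: "AE x\<in>\<Omega> in lebesgue. W x \<le> u x"
    using \<Omega>(1) by (simp add: AE_restrict_space_iff)
  show ?thesis
  proof (rule ccontr)
    assume "\<not> W x \<le> u x"
    \<comment> \<open>By continuity \<open>T\<close> is open, and the inequality just obtained makes
      it a null set. A nonempty open set is not null, so the inequality holds at every point of
      \<open>\<Omega>\<close>.\<close>
    define T where "T = {y \<in> \<Omega>. u y < W y}"
    have "open T"
    proof -
      have "continuous_on \<Omega> (\<lambda>y. u y - W y)"
        using continuous_on_subset[OF U(2) closure_subset] by (intro continuous_on_diff test_function_continuous[OF W])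
      then have "open ((\<lambda>y. u y - W y) -` {..<0} \<inter> \<Omega>)"
        using \<Omega>(1) by (simp add: continuous_on_open_vimage)
      moreover have "(\<lambda>y. u y - W y) -` {..<0} \<inter> \<Omega> = T" by (auto simp: T_def)
      ultimately show ?thesis by simp
    qed
    moreover have "AE y\<in>T in lebesgue. y \<in> {}"
      using ae by (rule AE_mp) (auto simp: T_def)
    ultimately show False
      using mem_closed_if_AE_lebesgue_open[of T "{}" x] x \<open>\<not> W x \<le> u x\<close> by (auto simp: T_def)
  qed
qed

section \<open>The barrier\<close>

lemma smooth_expr_sum:
  "finite I \<Longrightarrow> (\<And>i. i \<in> I \<Longrightarrow> smooth_expr S (f i)) \<Longrightarrow> smooth_expr S (\<lambda>x. \<Sum>i\<in>I. f i x)"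
proof (induction rule: finite_induct)
  case empty
  then show ?case using smooth_expr.const[of S 0] by simp
next
  case (insert i I)
  then have "smooth_expr S (\<lambda>x. f i x + (\<Sum>i\<in>I. f i x))" by (intro smooth_expr.add) auto
  then show ?case using insert by simp
qed

text \<open>For positive \<open>d\<close> this is positive exactly in the ball of radius d / sqrt 2.
  The value 1/2 at the centre, in place of 1, keeps the closed support of the bump inside the open
  ball of radius \<open>d\<close>, whose closure may touch the boundary.\<close>

definition cap :: "real ^ 'n \<Rightarrow> real \<Rightarrow> real ^ 'n \<Rightarrow> real"
  where "cap x0 d x = 1 / 2 - (x - x0) \<bullet> (x - x0) / d\<^sup>2"

lemma C_infinity_on_cap: "C_infinity_on UNIV (cap x0 d)"
proof -
  have "smooth_expr UNIV (\<lambda>x. 1 / 2 + (- 1 / d\<^sup>2) * (\<Sum>i\<in>UNIV. (x $ i + - x0 $ i) * (x $ i + - x0 $ i)))"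
    by (intro smooth_expr.add smooth_expr.mult smooth_expr.const smooth_expr_sum smooth_expr.component finite)
  then have "C_infinity_on UNIV (\<lambda>x. 1 / 2 + (- 1 / d\<^sup>2) * (\<Sum>i\<in>UNIV. (x $ i + - x0 $ i) * (x $ i + - x0 $ i)))"
    by (intro smooth_expr_C_infinity_on) auto
  moreover have "(\<lambda>x. 1 / 2 + (- 1 / d\<^sup>2) * (\<Sum>i\<in>UNIV. (x $ i + - x0 $ i) * (x $ i + - x0 $ i))) = cap x0 d"
    by (auto simp: cap_def inner_vec_def fun_eq_iff)
  ultimately show ?thesis by simp
qed

lemma cap_has_derivative: "(cap x0 d has_derivative (\<lambda>v. - 2 * ((x - x0) \<bullet> v) / d\<^sup>2)) (at x)"
proof -
  have "((\<lambda>x. 1 / 2 - (x - x0) \<bullet> (x - x0) * inverse (d\<^sup>2)) has_derivative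
      (\<lambda>v. 0 - ((x - x0) \<bullet> (v - 0) + (v - 0) \<bullet> (x - x0)) * inverse (d\<^sup>2))) (at x)"
    by (intro has_derivative_diff has_derivative_const has_derivative_mult_left has_derivative_inner
        has_derivative_ident)
  moreover have "0 - ((x - x0) \<bullet> (v - 0) + (v - 0) \<bullet> (x - x0)) * inverse (d\<^sup>2)
      = - 2 * ((x - x0) \<bullet> v) / d\<^sup>2" for v
    by (simp add: inner_commute divide_inverse)
  ultimately show ?thesis
    by (simp only: cap_def[abs_def] divide_inverse)
qed

lemma cap_nonpos:
  assumes "0 < d" "d\<^sup>2 \<le> 2 * (norm (x - x0))\<^sup>2"
  shows "cap x0 d x \<le> 0"
  using assms by (simp add: cap_def dot_square_norm field_simps)

text \<open>The bump \<open>W\<close> of the outline. Each derivative in \<open>x\<close> costs a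
  factor of order 1/d, so the factor \<open>d\<^sup>2\<close> makes the second derivatives of order
  \<open>a\<close> for every \<open>d\<close>.\<close>

definition barrier :: "real \<Rightarrow> real ^ 'n \<Rightarrow> real \<Rightarrow> real ^ 'n \<Rightarrow> real"
  where "barrier a x0 d x = a * d\<^sup>2 * bump 0 (cap x0 d x)"

lemma barrier_center: "barrier a x0 d x0 = a * exp (- 2) * d\<^sup>2"
  by (simp add: barrier_def cap_def bump_0)

lemma barrier_bounds:
  assumes "0 \<le> a"
  shows "0 \<le> barrier a x0 d x" "barrier a x0 d x \<le> a * d\<^sup>2"
  using assms bump_0_bounds[of "cap x0 d x"] by (auto simp: barrier_def intro!: mult_left_le)

lemma barrier_test_function:
  assumes "ball x0 d \<subseteq> \<Omega>" "0 < d"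
  shows "barrier a x0 d \<in> test_functions \<Omega>"
proof (rule test_functionsI)
  show "C_infinity_on UNIV (barrier a x0 d)"
    unfolding barrier_def[abs_def]
    by (intro C_infinity_on_mult[OF open_UNIV C_infinity_on_const] C_infinity_on_bump C_infinity_on_cap open_UNIV)
  show "{x. barrier a x0 d x \<noteq> 0} \<subseteq> cball x0 (d / sqrt 2)"
  proof
    fix x assume "x \<in> {x. barrier a x0 d x \<noteq> 0}"
    then have "\<not> cap x0 d x \<le> 0" using bump_nonpos by (auto simp: barrier_def)
    then have "2 * (norm (x - x0))\<^sup>2 < d\<^sup>2" using cap_nonpos[OF assms(2), of x x0] by linarith
    then have "(norm (x - x0))\<^sup>2 \<le> (d / sqrt 2)\<^sup>2" by (simp add: power_divide)
    then have "norm (x - x0) \<le> d / sqrt 2" by (rule power2_le_imp_le) (use assms(2) in simp)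
    then show "x \<in> cball x0 (d / sqrt 2)" by (simp add: dist_norm norm_minus_commute)
  qed
  have "d / sqrt 2 < d" using assms(2) by (simp add: divide_less_eq)
  then show "cball x0 (d / sqrt 2) \<subseteq> \<Omega>" using assms(1) by (auto simp: subset_eq)
qed simp

lemma partial_deriv_barrier:
  assumes "0 < d"
  shows "partial_deriv j (barrier a x0 d) = (\<lambda>x. - 2 * a * (bump (Suc 0) (cap x0 d x) * (x $ j - x0 $ j)))"
proof
  fix x
  have "((\<lambda>x. a * d\<^sup>2 * bump 0 (cap x0 d x)) has_derivative
      (\<lambda>v. a * d\<^sup>2 * (- 2 * ((x - x0) \<bullet> v) / d\<^sup>2 * bump (Suc 0) (cap x0 d x)))) (at x)"
    by (intro has_derivative_mult_right DERIV_compose_FDERIV[OF bump_has_derivative cap_has_derivative])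
  from partial_deriv_eq[OF this, of j]
  show "partial_deriv j (barrier a x0 d) x = - 2 * a * (bump (Suc 0) (cap x0 d x) * (x $ j - x0 $ j))"
    using assms by (simp add: barrier_def[abs_def] inner_axis) (simp add: algebra_simps)
qed

text \<open>The powers of \<open>d\<close> are distributed so that each coordinate difference is
  divided by one \<open>d\<close>; on the ball of radius \<open>d\<close> these quotients are at
  most 1 in modulus.\<close>

lemma partial_deriv2_barrier:
  assumes "0 < d"
  shows "partial_deriv i (partial_deriv j (barrier a x0 d)) x =
    - 2 * a * (bump (Suc 0) (cap x0 d x) * (if i = j then 1 else 0)
      - 2 * bump (Suc (Suc 0)) (cap x0 d x) * ((x $ i - x0 $ i) / d) * ((x $ j - x0 $ j) / d))"
proof -
  have "((\<lambda>x. - 2 * a * (bump (Suc 0) (cap x0 d x) * (x $ j - x0 $ j))) has_derivative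
      (\<lambda>v. - 2 * a * (bump (Suc 0) (cap x0 d x) * (v $ j - 0)
         + (- 2 * ((x - x0) \<bullet> v) / d\<^sup>2 * bump (Suc (Suc 0)) (cap x0 d x)) * (x $ j - x0 $ j)))) (at x)"
    by (intro has_derivative_mult_right has_derivative_mult has_derivative_diff has_derivative_component
        has_derivative_const DERIV_compose_FDERIV[OF bump_has_derivative cap_has_derivative])
  from partial_deriv_eq[OF this, of i]
  have "partial_deriv i (partial_deriv j (barrier a x0 d)) x =
      - 2 * a * (bump (Suc 0) (cap x0 d x) * (axis i 1 $ j - 0)
         + (- 2 * ((x - x0) \<bullet> axis i 1) / d\<^sup>2 * bump (Suc (Suc 0)) (cap x0 d x)) * (x $ j - x0 $ j))"
    by (simp only: partial_deriv_barrier[OF assms])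
  moreover have "axis i 1 $ j - 0 = (if i = j then 1 else 0 :: real)" by (simp add: axis_def)
  moreover have "(x - x0) \<bullet> axis i 1 = x $ i - x0 $ i" by (simp add: inner_axis)
  ultimately show ?thesis
    by (simp add: power2_eq_square) (simp add: divide_inverse algebra_simps)
qed

text \<open>Inside the ball of radius \<open>d\<close> every coordinate difference is at most
  \<open>d\<close>; outside, \<open>cap\<close> is nonpositive and all the \<open>bump n\<close>
  vanish. Uniformity in \<open>d\<close> is what lets one constant serve all centres.\<close>

lemma barrier_derivative_bounds:
  assumes D1: "\<And>t. \<bar>bump (Suc 0) t\<bar> \<le> D1" and D2: "\<And>t. \<bar>bump (Suc (Suc 0)) t\<bar> \<le> D2"
    and "0 < d" "0 \<le> a"
  shows "\<bar>partial_deriv j (barrier a x0 d) x\<bar> \<le> 2 * a * (D1 * d)"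
    and "\<bar>partial_deriv i (partial_deriv j (barrier a x0 d)) x\<bar> \<le> 2 * a * (D1 + 2 * D2)"
proof -
  have D0: "0 \<le> D1" "0 \<le> D2" using D1[of 0] D2[of 0] by linarith+
  have "\<bar>partial_deriv j (barrier a x0 d) x\<bar> \<le> 2 * a * (D1 * d) \<and>
    \<bar>partial_deriv i (partial_deriv j (barrier a x0 d)) x\<bar> \<le> 2 * a * (D1 + 2 * D2)"
  proof (cases "norm (x - x0) \<le> d")
    case True
    then have le: "\<bar>x $ k - x0 $ k\<bar> \<le> d" for k
      using component_le_norm_cart[of "x - x0" k] by simp
    have "\<bar>bump (Suc 0) (cap x0 d x) * (x $ j - x0 $ j)\<bar> \<le> D1 * d"
      unfolding abs_mult using D1 le D0 by (intro mult_mono) auto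
    then have "2 * a * \<bar>bump (Suc 0) (cap x0 d x) * (x $ j - x0 $ j)\<bar> \<le> 2 * a * (D1 * d)"
      using assms(4) by (intro mult_left_mono) auto
    then have 1: "\<bar>partial_deriv j (barrier a x0 d) x\<bar> \<le> 2 * a * (D1 * d)"
      unfolding partial_deriv_barrier[OF assms(3)] using assms(4) by (simp add: abs_mult)
    have le': "\<bar>(x $ k - x0 $ k) / d\<bar> \<le> 1" for k using le[of k] assms(3) by simp
    let ?A = "bump (Suc 0) (cap x0 d x) * (if i = j then 1 else 0)"
    let ?B = "bump (Suc (Suc 0)) (cap x0 d x) * ((x $ i - x0 $ i) / d) * ((x $ j - x0 $ j) / d)"
    have A: "\<bar>?A\<bar> \<le> D1" using D1 D0 by auto
    have "\<bar>?B\<bar> \<le> D2 * 1 * 1"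
      unfolding abs_mult using D2 le' D0 by (intro mult_mono mult_nonneg_nonneg) auto
    with A have "\<bar>?A - 2 * ?B\<bar> \<le> D1 + 2 * D2" by linarith
    then have "2 * a * \<bar>?A - 2 * ?B\<bar> \<le> 2 * a * (D1 + 2 * D2)"
      using assms(4) by (intro mult_left_mono) auto
    then have 2: "\<bar>partial_deriv i (partial_deriv j (barrier a x0 d)) x\<bar> \<le> 2 * a * (D1 + 2 * D2)"
      unfolding partial_deriv2_barrier[OF assms(3)] using assms(4) by (simp add: abs_mult mult.assoc)
    from 1 2 show ?thesis by simp
  next
    case False
    then have "d\<^sup>2 \<le> (norm (x - x0))\<^sup>2" using assms(3) by (intro power_mono) auto
    moreover have "0 \<le> (norm (x - x0))\<^sup>2" by simp
    ultimately have "cap x0 d x \<le> 0" by (intro cap_nonpos assms) linarith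
    then show ?thesis
      unfolding partial_deriv2_barrier[OF assms(3)] unfolding partial_deriv_barrier[OF assms(3)]
      using D0 assms(3,4) by (simp add: bump_nonpos)
  qed
  then show "\<bar>partial_deriv j (barrier a x0 d) x\<bar> \<le> 2 * a * (D1 * d)"
    and "\<bar>partial_deriv i (partial_deriv j (barrier a x0 d)) x\<bar> \<le> 2 * a * (D1 + 2 * D2)" by auto
qed

text \<open>In the product rule, second derivatives of the barrier meet the coefficients and first
  derivatives meet the derivatives of the coefficients. The radius bound \<open>R\<close> absorbs
  the factor \<open>d\<close> of the latter, so \<open>K\<close> depends neither on \<open>a\<close>
  nor on the ball.\<close>

lemma barrier_operator_bound:
  fixes \<Omega> :: "(real ^ 'n::finite) set" and \<sigma> :: "real ^ 'n \<Rightarrow> real ^ 'n ^ 'n"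
  assumes "open \<Omega>" and \<sigma>: "\<And>i j. C_infinity_on \<Omega> (\<lambda>x. \<sigma> x $ i $ j)"
    and S: "\<And>i j x. x \<in> \<Omega> \<Longrightarrow> \<bar>\<sigma> x $ i $ j\<bar> \<le> S"
      "\<And>i j k x. x \<in> \<Omega> \<Longrightarrow> \<bar>partial_deriv k (\<lambda>x. \<sigma> x $ i $ j) x\<bar> \<le> S"
  obtains K where "\<And>a x0 d x. 0 \<le> a \<Longrightarrow> 0 < d \<Longrightarrow> d \<le> R \<Longrightarrow> ball x0 d \<subseteq> \<Omega> \<Longrightarrow> x \<in> \<Omega> \<Longrightarrow>
    \<bar>\<Sum>i\<in>UNIV. \<Sum>j\<in>UNIV. partial_deriv i (\<lambda>x. \<sigma> x $ i $ j * partial_deriv j (barrier a x0 d) x) x\<bar> \<le> a * K"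
proof -
  obtain D1 where D1: "D1 > 0" "\<And>t. \<bar>bump (Suc 0) t\<bar> \<le> D1" using bump_bounded by blast
  obtain D2 where D2: "D2 > 0" "\<And>t. \<bar>bump (Suc (Suc 0)) t\<bar> \<le> D2" using bump_bounded by blast
  define K where "K = (\<Sum>i::'n\<in>UNIV. \<Sum>j::'n\<in>UNIV. S * (2 * (D1 + 2 * D2)) + S * (2 * (D1 * R)))"
  show ?thesis
  proof (rule that[of K])
    fix a d :: real and x0 x :: "real ^ 'n"
    assume a: "0 \<le> a" and d: "0 < d" "d \<le> R" and ball: "ball x0 d \<subseteq> \<Omega>" and x: "x \<in> \<Omega>"
    let ?W = "barrier a x0 d"
    \<comment> \<open>The indices are arbitrary: any matrix entry at \<open>x\<close> shows that
      \<open>S\<close> is nonnegative.\<close>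
    have S0: "0 \<le> S" using S(1)[OF x, of undefined undefined] by linarith
    have term_le: "\<bar>partial_deriv i (\<lambda>x. \<sigma> x $ i $ j * partial_deriv j ?W x) x\<bar>
        \<le> a * (S * (2 * (D1 + 2 * D2)) + S * (2 * (D1 * R)))" for i j
    proof -
      have "partial_deriv i (\<lambda>x. \<sigma> x $ i $ j * partial_deriv j ?W x) x =
          \<sigma> x $ i $ j * partial_deriv i (partial_deriv j ?W) x
          + partial_deriv i (\<lambda>x. \<sigma> x $ i $ j) x * partial_deriv j ?W x"
        by (rule partial_deriv_mult[OF C_infinity_on_differentiable[OF \<open>open \<Omega>\<close> \<sigma> x]
            test_function_differentiable[OF test_function_partial_deriv[OF barrier_test_function[OF ball d(1)]]]])
      also have "\<bar>\<dots>\<bar> \<le> \<bar>\<sigma> x $ i $ j\<bar> * \<bar>partial_deriv i (partial_deriv j ?W) x\<bar>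
          + \<bar>partial_deriv i (\<lambda>x. \<sigma> x $ i $ j) x\<bar> * \<bar>partial_deriv j ?W x\<bar>"
        unfolding abs_mult[symmetric] by (rule abs_triangle_ineq)
      also have "\<dots> \<le> S * (2 * a * (D1 + 2 * D2)) + S * (2 * a * (D1 * d))"
        using barrier_derivative_bounds[OF D1(2) D2(2) d(1) a] S x S0 by (intro add_mono mult_mono) auto
      also have "\<dots> \<le> S * (2 * a * (D1 + 2 * D2)) + S * (2 * a * (D1 * R))"
        using S0 a D1(1) d(2) by (intro add_left_mono mult_left_mono) auto
      finally show ?thesis by (simp add: algebra_simps)
    qed
    have "\<bar>\<Sum>i\<in>UNIV. \<Sum>j\<in>UNIV. partial_deriv i (\<lambda>x. \<sigma> x $ i $ j * partial_deriv j ?W x) x\<bar> \<le>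
        (\<Sum>i::'n\<in>UNIV. \<Sum>j::'n\<in>UNIV. a * (S * (2 * (D1 + 2 * D2)) + S * (2 * (D1 * R))))"
      by (intro order_trans[OF sum_abs] sum_mono term_le)
    then show "\<bar>\<Sum>i\<in>UNIV. \<Sum>j\<in>UNIV. partial_deriv i (\<lambda>x. \<sigma> x $ i $ j * partial_deriv j ?W x) x\<bar> \<le> a * K"
      by (simp add: K_def mult.left_commute)
  qed
qed

text \<open>The continuous extension of the derivative is bounded on the compact closure; this is
  where smoothness up to the boundary enters.\<close>

lemma C_infinity_closure_bounded:
  assumes "C_infinity_closure \<Omega> f" "bounded \<Omega>"
  obtains C where "0 \<le> C" "\<And>x. x \<in> \<Omega> \<Longrightarrow> \<bar>iter_partial_deriv is f x\<bar> \<le> C"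
proof -
  obtain g where g: "continuous_on (closure \<Omega>) g" "\<And>x. x \<in> \<Omega> \<Longrightarrow> g x = iter_partial_deriv is f x"
    using assms(1) unfolding C_infinity_closure_def by blast
  have "bounded (g ` closure \<Omega>)"
    using assms(2) by (intro compact_imp_bounded compact_continuous_image g(1)) simp
  then obtain C where C: "\<And>x. x \<in> closure \<Omega> \<Longrightarrow> \<bar>g x\<bar> \<le> C"
    by (auto simp: bounded_iff)
  show ?thesis
  proof (rule that[of "\<bar>C\<bar>"])
    show "\<bar>iter_partial_deriv is f x\<bar> \<le> \<bar>C\<bar>" if "x \<in> \<Omega>" for x
      using C[of x] g(2)[OF that] closure_subset[of \<Omega>] that by auto
  qed simp
qed

section \<open>Distance to the boundary\<close>

lemma ball_bdist_subset:
  fixes x :: "real ^ 'n"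
  assumes "x \<in> \<Omega>"
  shows "ball x (bdist \<Omega> x) \<subseteq> \<Omega>"
proof
  fix y assume y: "y \<in> ball x (bdist \<Omega> x)"
  show "y \<in> \<Omega>"
  proof (rule ccontr)
    assume "y \<notin> \<Omega>"
    with y have "ball x (bdist \<Omega> x) - \<Omega> \<noteq> {}" by blast
    moreover have "x \<in> ball x (bdist \<Omega> x) \<inter> \<Omega>"
      using assms y by (simp add: le_less_trans[OF zero_le_dist])
    \<comment> \<open>A ball is connected, so if it meets both \<open>\<Omega>\<close> and the
      complement, it contains a frontier point, which is then closer to the centre than the distance
      permits.\<close>
    ultimately obtain z where "z \<in> ball x (bdist \<Omega> x)" "z \<in> frontier \<Omega>"
      using connected_Int_frontier[of "ball x (bdist \<Omega> x)" \<Omega>] by blast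
    then show False using infdist_le[of z "frontier \<Omega>" x] by (simp add: bdist_def)
  qed
qed

text \<open>\<open>infdist\<close> to the empty set is 0 by convention, so positivity of the
  boundary distance rests on this. Only the empty set and the whole space have empty frontier, and
  the latter is unbounded.\<close>

lemma frontier_nonempty:
  fixes \<Omega> :: "(real ^ 'n) set"
  assumes "bounded \<Omega>" "\<Omega> \<noteq> {}"
  shows "frontier \<Omega> \<noteq> {}"
  using frontier_eq_empty assms not_bounded_UNIV by metis

lemma bdist_pos:
  assumes "open \<Omega>" "bounded \<Omega>" "x \<in> \<Omega>"
  shows "0 < bdist \<Omega> x"
proof -
  have "frontier \<Omega> \<noteq> {}" using assms by (intro frontier_nonempty) auto
  moreover have "x \<notin> frontier \<Omega>" using assms by (simp add: frontier_def interior_open)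
  ultimately show ?thesis
    unfolding bdist_def using infdist_pos_not_in_closed frontier_closed by blast
qed

lemma bdist_bounded:
  fixes \<Omega> :: "(real ^ 'n) set"
  assumes "bounded \<Omega>" "\<Omega> \<noteq> {}"
  obtains R where "0 < R" "\<And>x. x \<in> closure \<Omega> \<Longrightarrow> bdist \<Omega> x \<le> R"
proof -
  obtain z where z: "z \<in> frontier \<Omega>" using frontier_nonempty[OF assms] by blast
  obtain B where B: "\<And>x. x \<in> closure \<Omega> \<Longrightarrow> dist z x \<le> B"
    using bounded_closure[OF assms(1)] bounded_any_center[of "closure \<Omega>" z] by blast
  show ?thesis
  proof (rule that[of "max 1 B"])
    fix x assume "x \<in> closure \<Omega>"
    then show "bdist \<Omega> x \<le> max 1 B"
      using infdist_le[OF z, of x] B[of x] by (simp add: bdist_def dist_commute)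
  qed simp
qed

text \<open>One constant serves all points, all admissible \<open>q\<close> and all solutions,
  because \<open>a\<close> is fixed by bounds on the data alone. Interior points are treated by a
  barrier centred there; continuity extends the estimate to the closure.\<close>

lemma weak_solution_ge_bdist_squared:
  fixes \<Omega> :: "(real ^ 'n::finite) set" and \<sigma> :: "real ^ 'n \<Rightarrow> real ^ 'n ^ 'n"
  assumes dom: "open \<Omega>" "bounded \<Omega>" "\<Omega> \<noteq> {}"
    and m: "odd m"
    and f: "integrable (lebesgue_on \<Omega>) f"
    and smooth: "\<And>i j. C_infinity_closure \<Omega> (\<lambda>x. \<sigma> x $ i $ j)"
    and ell: "0 < lam" "AE x in lebesgue_on \<Omega>. \<forall>\<xi>. lam * (norm \<xi>)\<^sup>2 \<le> (\<sigma> x *v \<xi>) \<bullet> \<xi>"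
    and cf: "0 < cf" "AE x in lebesgue_on \<Omega>. cf \<le> f x"
    and q: "0 \<le> qlo" "qlo \<le> qhi"
  obtains c where "0 < c" "\<And>q u x. q \<in> admissible \<Omega> qlo qhi \<Longrightarrow> weak_solution \<Omega> \<sigma> m f q u \<Longrightarrow>
    x \<in> closure \<Omega> \<Longrightarrow> c * (bdist \<Omega> x)\<^sup>2 \<le> u x"
proof -
  have \<sigma>: "C_infinity_on \<Omega> (\<lambda>x. \<sigma> x $ i $ j)" for i j
    using smooth by (simp add: C_infinity_closure_def)
  have "\<exists>S. \<forall>i j k. \<forall>x\<in>\<Omega>. \<bar>\<sigma> x $ i $ j\<bar> \<le> S \<and> \<bar>partial_deriv k (\<lambda>x. \<sigma> x $ i $ j) x\<bar> \<le> S"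
  proof -
    have "\<exists>C\<ge>0. \<forall>x\<in>\<Omega>. \<bar>iter_partial_deriv is (\<lambda>x. \<sigma> x $ i $ j) x\<bar> \<le> C" for "is" i j
      using C_infinity_closure_bounded[OF smooth dom(2)] by metis
    then obtain C where C: "\<And>is i j. 0 \<le> C is i j"
      "\<And>is i j x. x \<in> \<Omega> \<Longrightarrow> \<bar>iter_partial_deriv is (\<lambda>x. \<sigma> x $ i $ j) x\<bar> \<le> C is i j" by metis
    \<comment> \<open>A sum of nonnegative constants over finitely many indices dominates each of
      them and gives a common bound.\<close>
    define S where "S = (\<Sum>(i, j, k)\<in>UNIV. C [] i j + C [k] i j)"
    have S: "C [] i j + C [k] i j \<le> S" for i j k
      unfolding S_def using C(1)
      by (intro member_le_sum[of "(i, j, k)" UNIV "\<lambda>(i, j, k). C [] i j + C [k] i j", simplified])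
         (auto intro: add_nonneg_nonneg)
    have "\<bar>\<sigma> x $ i $ j\<bar> \<le> S \<and> \<bar>partial_deriv k (\<lambda>x. \<sigma> x $ i $ j) x\<bar> \<le> S" if "x \<in> \<Omega>" for i j k x
      using C(2)[OF that, of "[]" i j] C(2)[OF that, of "[k]" i j] S[of i j k] C(1)[of "[]" i j] C(1)[of "[k]" i j]
      by simp
    then show ?thesis by blast
  qed
  then obtain S where S: "\<And>i j x. x \<in> \<Omega> \<Longrightarrow> \<bar>\<sigma> x $ i $ j\<bar> \<le> S"
    "\<And>i j k x. x \<in> \<Omega> \<Longrightarrow> \<bar>partial_deriv k (\<lambda>x. \<sigma> x $ i $ j) x\<bar> \<le> S" by blast
  obtain R where R: "0 < R" "\<And>x. x \<in> closure \<Omega> \<Longrightarrow> bdist \<Omega> x \<le> R"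
    using bdist_bounded[OF dom(2,3)] by blast
  obtain K where K: "\<And>a x0 d x. 0 \<le> a \<Longrightarrow> 0 < d \<Longrightarrow> d \<le> R \<Longrightarrow> ball x0 d \<subseteq> \<Omega> \<Longrightarrow> x \<in> \<Omega> \<Longrightarrow>
    \<bar>\<Sum>i\<in>UNIV. \<Sum>j\<in>UNIV. partial_deriv i (\<lambda>x. \<sigma> x $ i $ j * partial_deriv j (barrier a x0 d) x) x\<bar> \<le> a * K"
    using barrier_operator_bound[of \<Omega> \<sigma> S R] dom(1) \<sigma> S by blast
  \<comment> \<open>\<open>L\<close> collects the factors of \<open>a\<close> in the divergence and
    reaction terms; the summand 1 makes it positive. With the choice of \<open>a\<close> these terms
    use up at most half of \<open>cf\<close>, and the other half is the strict gap.\<close>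
  define L where "L = \<bar>K\<bar> + qhi * (R\<^sup>2) ^ m + 1"
  have L: "0 < L" using q by (simp add: L_def add_nonneg_pos)
  define a where "a = min 1 (cf / (2 * L))"
  have a: "0 < a" "a \<le> 1" using cf(1) L by (auto simp: a_def)
  have "a * L \<le> cf / (2 * L) * L" using L by (intro mult_right_mono) (auto simp: a_def)
  then have aL: "a * L \<le> cf / 2" using L by simp
  have interior: "a * exp (- 2) * (bdist \<Omega> x0)\<^sup>2 \<le> u x0"
    if qa: "q \<in> admissible \<Omega> qlo qhi" and u: "weak_solution \<Omega> \<sigma> m f q u" and x0: "x0 \<in> \<Omega>" for q u x0
  proof -
    define d where "d = bdist \<Omega> x0"
    have d: "0 < d" "d \<le> R" "ball x0 d \<subseteq> \<Omega>"
      using bdist_pos[OF dom(1,2) x0] R(2)[of x0] closure_subset[of \<Omega>] x0 ball_bdist_subset[OF x0]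
      by (auto simp: d_def)
    have "barrier a x0 d x0 \<le> u x0"
    proof (rule weak_solution_comparison[OF dom(1,2) \<sigma> S(1) ell f qa q(1) m
          barrier_test_function[OF d(3,1)] _ _ u x0])
      show "0 < cf / 2" using cf(1) by simp
      have "AE x in lebesgue_on \<Omega>. qlo \<le> q x \<and> q x \<le> qhi" using qa by (simp add: admissible_def)
      then show "AE x in lebesgue_on \<Omega>.
          - (\<Sum>i\<in>UNIV. \<Sum>j\<in>UNIV. partial_deriv i (\<lambda>x. \<sigma> x $ i $ j * partial_deriv j (barrier a x0 d) x) x)
          + q x * barrier a x0 d x ^ m - f x \<le> - (cf / 2)"
        using cf(2) AE_space
      proof eventually_elim
        case (elim x)
        have "barrier a x0 d x ^ m \<le> (a * R\<^sup>2) ^ m"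
        proof (rule power_mono)
          have "a * d\<^sup>2 \<le> a * R\<^sup>2" using a d by (intro mult_left_mono power_mono) auto
          then show "barrier a x0 d x \<le> a * R\<^sup>2" using barrier_bounds(2)[of a x0 d x] a by linarith
        qed (use a in \<open>auto intro: barrier_bounds\<close>)
        \<comment> \<open>Since \<open>a\<close> is at most 1 and \<open>m\<close> is at least 1,
          a^m <= a, so the reaction term too is bounded linearly in \<open>a\<close>.\<close>
        also have "\<dots> \<le> a * (R\<^sup>2) ^ m"
          unfolding power_mult_distrib
          using a odd_pos[OF m] power_decreasing[of 1 m a] by (intro mult_right_mono) auto
        finally have "q x * barrier a x0 d x ^ m \<le> qhi * (a * (R\<^sup>2) ^ m)"
          using elim(1) q barrier_bounds(1)[of a x0 d x] a by (intro mult_mono) auto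
        moreover have "- (\<Sum>i\<in>UNIV. \<Sum>j\<in>UNIV. partial_deriv i (\<lambda>x. \<sigma> x $ i $ j * partial_deriv j (barrier a x0 d) x) x)
            \<le> a * \<bar>K\<bar>"
        proof -
          have "x \<in> \<Omega>" using elim(3) by simp
          moreover have "a * K \<le> a * \<bar>K\<bar>" using a by (intro mult_left_mono) auto
          ultimately show ?thesis using K[of a d x0 x] a d by linarith
        qed
        moreover have "a * \<bar>K\<bar> + qhi * (a * (R\<^sup>2) ^ m) \<le> a * L"
          using a by (simp add: L_def algebra_simps)
        ultimately show ?case using elim(2) aL by linarith
      qed
    qed
    then show ?thesis by (simp add: barrier_center d_def)
  qed
  show ?thesis
  \<comment> \<open>exp(-2) is the value of \<open>bump 0\<close> at 1/2, the height of
    \<open>cap\<close> at the centre.\<close>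
  proof (rule that[of "a * exp (- 2)"])
    show "0 < a * exp (- 2)" using a by simp
    fix q u x
    assume qa: "q \<in> admissible \<Omega> qlo qhi" and u: "weak_solution \<Omega> \<sigma> m f q u" and x: "x \<in> closure \<Omega>"
    have "continuous_on (closure \<Omega>) u" using u by (simp add: weak_solution_def)
    then have "continuous_on (closure \<Omega>) (\<lambda>x. u x - a * exp (- 2) * (bdist \<Omega> x)\<^sup>2)"
      unfolding bdist_def by (intro continuous_intros)
    from continuous_ge_on_closure[OF this x, of 0] show "a * exp (- 2) * (bdist \<Omega> x)\<^sup>2 \<le> u x"
      using interior[OF qa u] by simp
  qed
qed

text \<open>The solution u(q) appears as any function satisfying \<open>weak_solution\<close>, and
  the constants are chosen before it. Both claims are read off from the quadratic bound.\<close>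

theorem proposition3p12:
  fixes \<Omega> :: "(real ^ 'n::finite) set"
    and \<sigma> :: "real ^ 'n \<Rightarrow> real ^ 'n ^ 'n"
    and f :: "real ^ 'n \<Rightarrow> real"
    and m :: nat
    and r lam_lo lam_hi cf qlo qhi :: real
  assumes dim: "CARD('n) = 2 \<or> CARD('n) = 3"
    and dom: "open \<Omega>" "\<Omega> \<noteq> {}" "bounded \<Omega>" "convex \<Omega>"
    and m: "m \<ge> 1" "odd m"
    and r: "r > real CARD('n) / 2"
    and f: "f \<in> Lp_on r \<Omega>"
    and sigma_smooth: "\<forall>i j. C_infinity_closure \<Omega> (\<lambda>x. \<sigma> x $ i $ j)"
    and sigma_sym: "\<forall>x\<in>closure \<Omega>. transpose (\<sigma> x) = \<sigma> x"
    and lam: "0 < lam_lo" "lam_lo \<le> lam_hi"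
    and sigma_ell: "AE x in lebesgue_on \<Omega>. \<forall>\<xi>.
          lam_lo * (norm \<xi>)\<^sup>2 \<le> (\<sigma> x *v \<xi>) \<bullet> \<xi> \<and> (\<sigma> x *v \<xi>) \<bullet> \<xi> \<le> lam_hi * (norm \<xi>)\<^sup>2"
    and cf: "cf > 0" "AE x in lebesgue_on \<Omega>. f x \<ge> cf"
    and q: "0 \<le> qlo" "qlo \<le> qhi"
  shows "(\<exists>c>0. \<forall>q\<in>admissible \<Omega> qlo qhi. \<forall>u. weak_solution \<Omega> \<sigma> m f q u \<longrightarrow>
            (\<forall>x\<in>closure \<Omega>.
               u x \<ge> (if m > 1 then c * bdist \<Omega> x powr (2 + 1 / (real m - 1))
                       else c * (bdist \<Omega> x)\<^sup>2))) \<and>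
         (\<forall>q\<in>admissible \<Omega> qlo qhi. \<exists>C>0. \<exists>\<gamma>>0. \<forall>u. weak_solution \<Omega> \<sigma> m f q u \<longrightarrow>
            (\<forall>x\<in>closure \<Omega>. u x \<ge> C * bdist \<Omega> x powr \<gamma>))"
proof -
  \<comment> \<open>In dimension 2 or 3 the condition on \<open>r\<close> gives r > 1, which
    suffices on a bounded domain.\<close>
  have "integrable (lebesgue_on \<Omega>) f"
    using dim r by (intro Lp_on_integrable[OF dom(1,3) f]) auto
  moreover have "AE x in lebesgue_on \<Omega>. \<forall>\<xi>. lam_lo * (norm \<xi>)\<^sup>2 \<le> (\<sigma> x *v \<xi>) \<bullet> \<xi>"
    using sigma_ell by (rule AE_mp) simp
  ultimately obtain c where c: "0 < c" and ge: "\<And>q u x. q \<in> admissible \<Omega> qlo qhi \<Longrightarrow> weak_solution \<Omega> \<sigma> m f q u \<Longrightarrow>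
    x \<in> closure \<Omega> \<Longrightarrow> c * (bdist \<Omega> x)\<^sup>2 \<le> u x"
    using weak_solution_ge_bdist_squared[OF dom(1,3,2) m(2) _ sigma_smooth[rule_format] lam(1) _ cf q] by blast
  obtain R where R: "0 < R" "\<And>x. x \<in> closure \<Omega> \<Longrightarrow> bdist \<Omega> x \<le> R"
    using bdist_bounded[OF dom(3,2)] by blast
  have b0: "0 \<le> bdist \<Omega> x" for x by (simp add: bdist_def infdist_nonneg)
  define s where "s = 1 / (real m - 1)"
  \<comment> \<open>The distance is at most \<open>R\<close>, so its additional power is at most
    \<open>R powr s\<close>; dividing \<open>c\<close> by this number absorbs it.\<close>
  define c' where "c' = (if m > 1 then c / R powr s else c)"
  have powr_le: "c' * bdist \<Omega> x powr (2 + s) \<le> c * (bdist \<Omega> x)\<^sup>2" if "m > 1" "x \<in> closure \<Omega>" for x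
  proof -
    have "bdist \<Omega> x powr s \<le> R powr s"
      using that(1) R(2)[OF that(2)] b0 by (intro powr_mono2) (auto simp: s_def)
    then have "c * (bdist \<Omega> x)\<^sup>2 * (bdist \<Omega> x powr s / R powr s) \<le> c * (bdist \<Omega> x)\<^sup>2 * 1"
      using c R(1) by (intro mult_left_mono) auto
    then show ?thesis using that(1) b0[of x] by (simp add: powr_add c'_def)
  qed
  show ?thesis
  proof (intro conjI)
    show "\<exists>c>0. \<forall>q\<in>admissible \<Omega> qlo qhi. \<forall>u. weak_solution \<Omega> \<sigma> m f q u \<longrightarrow>
            (\<forall>x\<in>closure \<Omega>.
               u x \<ge> (if m > 1 then c * bdist \<Omega> x powr (2 + 1 / (real m - 1))
                       else c * (bdist \<Omega> x)\<^sup>2))"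
    proof (intro exI[of _ c'] conjI ballI allI impI)
      show "0 < c'" using c R(1) by (simp add: c'_def)
      fix q u x
      assume "q \<in> admissible \<Omega> qlo qhi" "weak_solution \<Omega> \<sigma> m f q u" and x: "x \<in> closure \<Omega>"
      from ge[OF this] powr_le[OF _ x]
      show "u x \<ge> (if m > 1 then c' * bdist \<Omega> x powr (2 + 1 / (real m - 1)) else c' * (bdist \<Omega> x)\<^sup>2)"
        by (auto simp: s_def c'_def split: if_splits)
    qed
    show "\<forall>q\<in>admissible \<Omega> qlo qhi. \<exists>C>0. \<exists>\<gamma>>0. \<forall>u. weak_solution \<Omega> \<sigma> m f q u \<longrightarrow>
            (\<forall>x\<in>closure \<Omega>. u x \<ge> C * bdist \<Omega> x powr \<gamma>)"
      \<comment> \<open>The exponent 2 is taken; \<open>powr\<close> agrees with the square because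
        the distance is nonnegative.\<close>
      using ge c b0 by (intro ballI exI[of _ c] conjI exI[of _ 2]) auto
  qed
qed

end
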